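(* Let $s_0=\lceil\log_2\log_2 4n\rceil$ and $c=\frac{3+\sqrt{33}}4$, and run the algorithm AdaVRAG (described in the context) with $$a^{(s)}=\begin{cases}1-(4n)^{-0.5^{s}}&1\le s\le s_0\\ \frac{c}{s-s_0+2c}&s>s_0\end{cases},\qquad q^{(s)}=\begin{cases}\frac1{(1-a^{(s)})a^{(s)}}&1\le s\le s_0\\ \frac{8(2-a^{(s)})a^{(s)}}{3(1-a^{(s)})}&s>s_0\end{cases},\qquad T_s=n,$$ where $(4n)^{-0.5^s}$ means $(4n)^{-(0.5^s)}$. Suppose $\mathcal X$ is a compact convex set with diameter $D$ and $\eta=\Theta(D)$, and additionally that $2\eta^2>D^2$ if Option I is used for the step size. Set $$V=\frac12(F(u^{(0)})-F(x^* ))+\gamma\|u^{(0)}-x^*\|^2+\left[\beta-\left(1-\frac{D^2}{2\eta^2}\right)\gamma\right]^+\left(D^2+2(\eta^2+D^2)\log\frac{\frac{2\eta^2\beta}{2\eta^2-D^2}}{\gamma}\right)$$ for Option I, and $$V=\frac12(F(u^{(0)})-F(x^* ))+\gamma\|u^{(0)}-x^*\|^2+\eta^2\left(\frac{D^2}{\eta^2}+\beta-\gamma\right)^+\left(\frac{2D^2}{\eta^2}+\beta-\gamma\right)$$ for Option II. Then for every $\epsilon>0$ there is a number of epochs $S\ge1$ such that the output satisfies $\mathbb E[F(u^{(S)})-F(x^* )]\le\epsilon$ and the number of individual gradient evaluations used is $$\#grads=\begin{cases}\mathcal O\left(n\log\log\frac V\epsilon\right)&\epsilon\ge\frac Vn\\[2pt]\mathcal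 O\left(n\log\log n+\sqrt{\frac{nV}\epsilon}\right)&\epsilon<\frac Vn\end{cases}.$$
   Context: Problem. $n,d\ge1$ are integers, $\mathcal X\subseteq\mathbb R^d$ is a nonempty closed convex set, $f_1,\dots,f_n:\mathbb R^d\to\mathbb R$ are convex, differentiable and $\beta$-smooth with $\beta>0$, i.e. $\|\nabla f_i(x)-\nabla f_i(y)\|\le\beta\|x-y\|$ for all $x,y\in\mathbb R^d$; $f=\frac1n\sum_{i=1}^n f_i$; $h:\mathcal X\to\mathbb R$ is convex, possibly nonsmooth, and such that $\arg\min_{x\in\mathcal X}(\lambda h(x)+\frac12\|x-v\|^2)$ exists for all $\lambda\ge0$, $v\in\mathbb R^d$. $F=f+h$ and $x^*\in\arg\min_{x\in\mathcal X}F(x)$ (assumed to exist). $\|\cdot\|$ is the Euclidean norm; $y^+=\max\{y,0\}$. "Diameter $D$" means $\sup_{x,y\in\mathcal X}\|x-y\|\le D$, $D>0$; $\eta=\Theta(D)$ means $\eta$ is a fixed positive constant multiple of $D$. Algorithm AdaVRAG. Input $u^{(0)}\in\mathcal X$. Parameters: $a^{(s)}\in(0,1)$, $q^{(s)}>0$, positive integers $T_s$ ($s\ge1$), $\eta>0$, $\gamma>0$. Initialize $x_0^{(1)}=u^{(0)}$, $\gamma_0^{(1)}=\gamma$. For $s=1,\dots,S$: set $\overline x_0^{(s)}=a^{(s)}x_0^{(s)}+(1-a^{(s)})u^{(s-1)}$ and compute $\nabla f(u^{(s-1)})$; for $t=1,\dots,T_s$: - draw $i_t^{(s)}$ uniformly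 from $\{1,\dots,n\}$, independently of everything before, and set $g_t^{(s)}=\nabla f_{i_t^{(s)}}(\overline x_{t-1}^{(s)})-\nabla f_{i_t^{(s)}}(u^{(s-1)})+\nabla f(u^{(s-1)})$; - $x_t^{(s)}=\arg\min_{x\in\mathcal X}\{\langle g_t^{(s)},x\rangle+h(x)+\frac{\gamma_{t-1}^{(s)}q^{(s)}}2\|x-x_{t-1}^{(s)}\|^2\}$; - $\overline x_t^{(s)}=a^{(s)}x_t^{(s)}+(1-a^{(s)})u^{(s-1)}$; - Option I: $\gamma_t^{(s)}=\gamma_{t-1}^{(s)}\sqrt{1+\frac{\|x_t^{(s)}-x_{t-1}^{(s)}\|^2}{\eta^2}}$; Option II: $\gamma_t^{(s)}=\gamma_{t-1}^{(s)}+\frac{\|x_t^{(s)}-x_{t-1}^{(s)}\|^2}{\eta^2}$ (one option is fixed for the whole run). At the end of epoch $s$: $u^{(s)}=\frac1{T_s}\sum_{t=1}^{T_s}\overline x_t^{(s)}$, $x_0^{(s+1)}=x_{T_s}^{(s)}$, $\gamma_0^{(s+1)}=\gamma_{T_s}^{(s)}$. Output $u^{(S)}$. Counting. An evaluation of some $\nabla f_i$ at a point counts as one individual gradient evaluation; computing $\nabla f$ at a point counts as $n$. $\mathcal O(\cdot)$ hides absolute constants; iterated logarithms $\log\log(\cdot)$ inside $\mathcal O$ are read as $\max\{1,\log\log(\cdot)\}$ (and as $1$ when undefined). *)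

theory Defs
  imports "HOL-Probability.Probability" "HOL-Library.Monad_Syntax"
begin

text \<open>
  The constant hidden in an \<open>O\<close>-bound has to be the same for all dimensions, so the dimension \<open>d\<close>
  must be a bound variable and \<^typ>\<open>real ^ 'd\<close> cannot be used. Instead, all spaces
  \<open>\<real>\<^sup>d\<close> are realised as nested subspaces of one inner product space, the finitely
  supported real sequences: \<open>\<real>\<^sup>d\<close> consists of the sequences that vanish from index
  \<open>d\<close> on, with the Euclidean inner product.
\<close>

typedef fvec = "{x :: nat \<Rightarrow> real. finite {i. x i \<noteq> 0}}"
  morphisms coord Abs_fvec
  by (rule exI[of _ "\<lambda>_. 0"]) simp

lemma finite_coord [simp]: "finite {i. coord x i \<noteq> 0}"
  using coord[of x] by simp

lemma fvec_eqI: "(\<And>i. coord x i = coord y i) \<Longrightarrow> x = y"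
  by (metis coord_inject ext)

lemma coord_Abs: "finite {i. x i \<noteq> 0} \<Longrightarrow> coord (Abs_fvec x) = x"
  by (simp add: Abs_fvec_inverse)

instantiation fvec :: real_vector
begin

definition "0 = Abs_fvec (\<lambda>_. 0)"
definition "x + y = Abs_fvec (\<lambda>i. coord x i + coord y i)"
definition "- x = Abs_fvec (\<lambda>i. - coord x i)"
definition "x - y = Abs_fvec (\<lambda>i. coord x i - coord y i)"
definition "r *\<^sub>R x = Abs_fvec (\<lambda>i. r * coord x i)"

lemma coord_zero [simp]: "coord 0 i = 0"
  by (simp add: zero_fvec_def coord_Abs)

lemma coord_add [simp]: "coord (x + y) i = coord x i + coord y i"
proof -
  have "finite {i. coord x i + coord y i \<noteq> 0}"
    by (rule finite_subset[of _ "{i. coord x i \<noteq> 0} \<union> {i. coord y i \<noteq> 0}"]) auto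
  then show ?thesis by (simp add: plus_fvec_def coord_Abs)
qed

lemma coord_uminus [simp]: "coord (- x) i = - coord x i"
  by (simp add: uminus_fvec_def coord_Abs)

lemma coord_diff [simp]: "coord (x - y) i = coord x i - coord y i"
proof -
  have "finite {i. coord x i - coord y i \<noteq> 0}"
    by (rule finite_subset[of _ "{i. coord x i \<noteq> 0} \<union> {i. coord y i \<noteq> 0}"]) auto
  then show ?thesis by (simp add: minus_fvec_def coord_Abs)
qed

lemma coord_scaleR [simp]: "coord (r *\<^sub>R x) i = r * coord x i"
proof -
  have "finite {i. r * coord x i \<noteq> 0}"
    by (rule finite_subset[of _ "{i. coord x i \<noteq> 0}"]) auto
  then show ?thesis by (simp add: scaleR_fvec_def coord_Abs)
qed

instance
  by standard (auto intro!: fvec_eqI simp: algebra_simps)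

end

instantiation fvec :: real_inner
begin

definition "x \<bullet> y = (\<Sum>i | coord x i \<noteq> 0. coord x i * coord y i)"
definition "norm (x :: fvec) = sqrt (x \<bullet> x)"
definition "sgn (x :: fvec) = x /\<^sub>R norm x"
definition "dist (x :: fvec) y = norm (x - y)"
definition "(uniformity :: (fvec \<times> fvec) filter) =
  (INF e\<in>{0<..}. principal {(x, y). dist x y < e})"
definition "open (U :: fvec set) \<longleftrightarrow>
  (\<forall>x\<in>U. eventually (\<lambda>(x', y). x' = x \<longrightarrow> y \<in> U) uniformity)"

lemma inner_fvec_superset:
  assumes "finite A" "{i. coord x i \<noteq> 0} \<subseteq> A"
  shows "x \<bullet> y = (\<Sum>i\<in>A. coord x i * coord y i)"
  unfolding inner_fvec_def using assms by (intro sum.mono_neutral_left) auto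

instance
proof
  fix x y z :: fvec and r :: real
  define A where "A = {i. coord x i \<noteq> 0} \<union> {i. coord y i \<noteq> 0} \<union> {i. coord z i \<noteq> 0}"
  have A: "finite A" "\<And>v. {i. coord v i \<noteq> 0} \<subseteq> A \<Longrightarrow> v \<bullet> w = (\<Sum>i\<in>A. coord v i * coord w i)"
    for w
    by (auto simp: A_def intro!: inner_fvec_superset)
  show "x \<bullet> y = y \<bullet> x"
    by (subst (1 2) A(2)) (auto simp: A_def mult.commute)
  show "(x + y) \<bullet> z = x \<bullet> z + y \<bullet> z"
    by (subst (1 2 3) A(2)) (auto simp: A_def algebra_simps sum.distrib)
  show "(r *\<^sub>R x) \<bullet> y = r * (x \<bullet> y)"
    by (subst (1 2) A(2)) (auto simp: A_def sum_distrib_left mult_ac)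
  show "0 \<le> x \<bullet> x"
    by (auto simp: inner_fvec_def intro: sum_nonneg)
  show "x \<bullet> x = 0 \<longleftrightarrow> x = 0"
  proof
    assume "x \<bullet> x = 0"
    then have "\<forall>i\<in>{i. coord x i \<noteq> 0}. coord x i * coord x i = 0"
      unfolding inner_fvec_def by (subst (asm) sum_nonneg_eq_0_iff) auto
    then show "x = 0" by (intro fvec_eqI) auto
  qed (simp add: inner_fvec_def)
qed (rule norm_fvec_def sgn_fvec_def dist_fvec_def uniformity_fvec_def open_fvec_def)+

end

definition euclid :: "nat \<Rightarrow> fvec set" where
  "euclid d = {x. \<forall>i\<ge>d. coord x i = 0}"

lemma bij_betw_coord_euclid: "bij_betw coord (euclid d) {v. \<forall>i\<ge>d. v i = 0}"
proof (rule bij_betw_byWitness[where f' = Abs_fvec])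
  have fin: "finite {i. v i \<noteq> 0}" if "\<forall>i\<ge>d. v i = 0" for v :: "nat \<Rightarrow> real"
    by (rule finite_subset[of _ "{..<d}"]) (use that in \<open>auto simp: not_less[symmetric]\<close>)
  show "Abs_fvec ` {v. \<forall>i\<ge>d. v i = 0} \<subseteq> euclid d"
    by (auto simp: euclid_def coord_Abs fin)
  show "\<forall>v\<in>{v. \<forall>i\<ge>d. v i = 0}. coord (Abs_fvec v) = v"
    by (auto simp: coord_Abs fin)
qed (auto simp: euclid_def coord_inverse)

lemma subspace_euclid: "subspace (euclid d)"
  by (auto simp: subspace_def euclid_def)

lemma inner_euclid: "x \<in> euclid d \<Longrightarrow> x \<bullet> y = (\<Sum>i<d. coord x i * coord y i)"
  by (rule inner_fvec_superset) (auto simp: euclid_def not_less[symmetric])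

lemma norm_euclid: "x \<in> euclid d \<Longrightarrow> norm x = L2_set (coord x) {..<d}"
  by (simp add: norm_eq_sqrt_inner inner_euclid L2_set_def power2_eq_square)

text \<open>
  Functions on \<open>\<real>\<^sup>d\<close> are total functions on \<^typ>\<open>fvec\<close> of which only the values on
  \<^term>\<open>euclid d\<close> matter. The gradient is the unique vector of \<open>\<real>\<^sup>d\<close> that
  represents the derivative along \<open>\<real>\<^sup>d\<close>.
\<close>

definition gradient :: "nat \<Rightarrow> (fvec \<Rightarrow> real) \<Rightarrow> fvec \<Rightarrow> fvec" where
  "gradient d \<phi> x =
     (THE g. g \<in> euclid d \<and> (\<phi> has_derivative (\<lambda>v. g \<bullet> v)) (at x within euclid d))"

definition average :: "nat \<Rightarrow> (nat \<Rightarrow> fvec \<Rightarrow> real) \<Rightarrow> fvec \<Rightarrow> real" where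
  "average n f x = (\<Sum>i=1..n. f i x) / real n"

definition objective :: "nat \<Rightarrow> (nat \<Rightarrow> fvec \<Rightarrow> real) \<Rightarrow> (fvec \<Rightarrow> real) \<Rightarrow> fvec \<Rightarrow> real" where
  "objective n f h x = average n f x + h x"

definition composite_problem ::
  "nat \<Rightarrow> nat \<Rightarrow> fvec set \<Rightarrow> (nat \<Rightarrow> fvec \<Rightarrow> real) \<Rightarrow> (fvec \<Rightarrow> real) \<Rightarrow> real \<Rightarrow> bool" where
  "composite_problem n d X f h \<beta> \<longleftrightarrow>
     n \<ge> 1 \<and> d \<ge> 1 \<and> \<beta> > 0 \<and>
     X \<subseteq> euclid d \<and> X \<noteq> {} \<and> closed X \<and> convex X \<and>
     (\<forall>i\<in>{1..n}.
        convex_on (euclid d) (f i) \<and>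
        f i differentiable_on euclid d \<and>
        (\<forall>x\<in>euclid d. \<forall>y\<in>euclid d.
           norm (gradient d (f i) x - gradient d (f i) y) \<le> \<beta> * norm (x - y))) \<and>
     convex_on X h \<and>
     (\<forall>l\<ge>0. \<forall>v\<in>euclid d. \<exists>z. is_arg_min (\<lambda>x. l * h x + (1/2) * (norm (x - v))\<^sup>2) (\<lambda>x. x \<in> X) z)"

datatype step_option = Option_I | Option_II

fun next_gamma :: "step_option \<Rightarrow> real \<Rightarrow> real \<Rightarrow> fvec \<Rightarrow> fvec \<Rightarrow> real" where
  "next_gamma Option_I \<eta> \<gamma> x x' = \<gamma> * sqrt (1 + (norm (x' - x))\<^sup>2 / \<eta>\<^sup>2)"
| "next_gamma Option_II \<eta> \<gamma> x x' = \<gamma> + (norm (x' - x))\<^sup>2 / \<eta>\<^sup>2"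

text \<open>
  The inner loop of one epoch with snapshot \<open>u\<close>, started in the point \<open>x0\<close> with
  step size parameter \<open>\<gamma>0\<close>. After \<open>t\<close> iterations the state consists of
  \<open>x\<^sub>t\<close>, \<open>\<gamma>\<^sub>t\<close>, the sum of the averaged points of iterations \<open>1..t\<close>, and the
  number of individual gradient evaluations made so far in the epoch: initially the \<open>n\<close> for the full
  gradient in \<open>u\<close>, and then two for each iteration.
\<close>

fun epoch ::
  "nat \<Rightarrow> nat \<Rightarrow> fvec set \<Rightarrow> (nat \<Rightarrow> fvec \<Rightarrow> real) \<Rightarrow> (fvec \<Rightarrow> real) \<Rightarrow>
   step_option \<Rightarrow> real \<Rightarrow> real \<Rightarrow> real \<Rightarrow> fvec \<Rightarrow> fvec \<Rightarrow> real \<Rightarrow> nat \<Rightarrow>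
   (fvec \<times> real \<times> fvec \<times> nat) pmf" where
  "epoch n d X f h opt \<eta> a q u x0 \<gamma>0 0 = return_pmf (x0, \<gamma>0, 0, n)"
| "epoch n d X f h opt \<eta> a q u x0 \<gamma>0 (Suc t) =
     do {
       (x, \<gamma>, y, N) \<leftarrow> epoch n d X f h opt \<eta> a q u x0 \<gamma>0 t;
       i \<leftarrow> pmf_of_set {1..n};
       let xbar = a *\<^sub>R x + (1 - a) *\<^sub>R u;
           g = gradient d (f i) xbar - gradient d (f i) u + gradient d (average n f) u;
           x' = arg_min_on (\<lambda>z. g \<bullet> z + h z + \<gamma> * q / 2 * (norm (z - x))\<^sup>2) X;
           xbar' = a *\<^sub>R x' + (1 - a) *\<^sub>R u
       in return_pmf (x', next_gamma opt \<eta> \<gamma> x x', y + xbar', N + 2)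
     }"

text \<open>
  The state after \<open>s\<close> epochs: snapshot \<open>u\<^sup>(\<^sup>s\<^sup>)\<close>, starting point and step size parameter
  of the next epoch, and the number of individual gradient evaluations made so far.
\<close>

fun adavrag ::
  "nat \<Rightarrow> nat \<Rightarrow> fvec set \<Rightarrow> (nat \<Rightarrow> fvec \<Rightarrow> real) \<Rightarrow> (fvec \<Rightarrow> real) \<Rightarrow>
   step_option \<Rightarrow> real \<Rightarrow> (nat \<Rightarrow> real) \<Rightarrow> (nat \<Rightarrow> real) \<Rightarrow> (nat \<Rightarrow> nat) \<Rightarrow> fvec \<Rightarrow> real \<Rightarrow> nat \<Rightarrow>
   (fvec \<times> fvec \<times> real \<times> nat) pmf" where
  "adavrag n d X f h opt \<eta> a q T u0 \<gamma>0 0 = return_pmf (u0, u0, \<gamma>0, 0)"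
| "adavrag n d X f h opt \<eta> a q T u0 \<gamma>0 (Suc s) =
     do {
       (u, x, \<gamma>, N) \<leftarrow> adavrag n d X f h opt \<eta> a q T u0 \<gamma>0 s;
       (x', \<gamma>', y, M) \<leftarrow> epoch n d X f h opt \<eta> (a (Suc s)) (q (Suc s)) u x \<gamma> (T (Suc s));
       return_pmf (y /\<^sub>R real (T (Suc s)), x', \<gamma>', N + M)
     }"

definition s0 :: "nat \<Rightarrow> nat" where
  "s0 n = nat \<lceil>log 2 (log 2 (4 * real n))\<rceil>"

definition c0 :: real where
  "c0 = (3 + sqrt 33) / 4"

definition a_sched :: "nat \<Rightarrow> nat \<Rightarrow> real" where
  "a_sched n s =
     (if s \<le> s0 n then 1 - (4 * real n) powr (- ((1/2) ^ s))
      else c0 / (real s - real (s0 n) + 2 * c0))"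

definition q_sched :: "nat \<Rightarrow> nat \<Rightarrow> real" where
  "q_sched n s =
     (if s \<le> s0 n then 1 / ((1 - a_sched n s) * a_sched n s)
      else 8 * (2 - a_sched n s) * a_sched n s / (3 * (1 - a_sched n s)))"

text \<open>In \<open>V_const\<close>, \<open>\<Delta>\<close> is the initial gap \<open>F(u\<^sup>(\<^sup>0\<^sup>)) - F(x\<^sup>*)\<close> and
  \<open>r\<close> the initial distance \<open>\<parallel>u\<^sup>(\<^sup>0\<^sup>) - x\<^sup>*\<parallel>\<close>.\<close>

fun V_const :: "step_option \<Rightarrow> real \<Rightarrow> real \<Rightarrow> real \<Rightarrow> real \<Rightarrow> real \<Rightarrow> real \<Rightarrow> real" where
  "V_const Option_I \<beta> \<gamma> \<eta> D \<Delta> r =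
     \<Delta> / 2 + \<gamma> * r\<^sup>2 +
     max (\<beta> - (1 - D\<^sup>2 / (2 * \<eta>\<^sup>2)) * \<gamma>) 0 *
       (D\<^sup>2 + 2 * (\<eta>\<^sup>2 + D\<^sup>2) * ln ((2 * \<eta>\<^sup>2 * \<beta> / (2 * \<eta>\<^sup>2 - D\<^sup>2)) / \<gamma>))"
| "V_const Option_II \<beta> \<gamma> \<eta> D \<Delta> r =
     \<Delta> / 2 + \<gamma> * r\<^sup>2 +
     \<eta>\<^sup>2 * max (D\<^sup>2 / \<eta>\<^sup>2 + \<beta> - \<gamma>) 0 * (2 * D\<^sup>2 / \<eta>\<^sup>2 + \<beta> - \<gamma>)"

text \<open>The iterated logarithm of complexity bounds: at least \<open>1\<close>, and \<open>1\<close> where undefined.\<close>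

definition loglog :: "real \<Rightarrow> real" where
  "loglog x = (if x > 1 then max 1 (ln (ln x)) else 1)"

end

theory Submission
  imports Defs
begin

text \<open>
  Let \<open>w\<^sub>0 = 1/2\<close> and \<open>w\<^sub>s = 2 n / (a\<^sup>(\<^sup>s\<^sup>) q\<^sup>(\<^sup>s\<^sup>))\<close>. In an inner iteration the variance
  of the gradient estimate is at most \<open>2 \<beta>\<close> times the gap of the tangent inequality between the
  snapshot and the current point, by cocoercivity. Young's inequality balances it against exactly the
  slack that the tangent inequality leaves for the weight \<open>1 - a\<close> of the snapshot. What remains is
  \<open>\<gamma>\<close> times the decrease of the squared distance to the minimizer plus \<open>(\<beta> - \<gamma>)\<close> times the squared
  step length; both are absorbed by the decrease of \<open>V\<close>, viewed as a function of the current step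
  size and distance. Hence \<open>w\<^sub>s (F(u\<^sup>(\<^sup>s\<^sup>)) - F(x\<^sup>*)) + V\<close> (with the gap dropped from \<open>V\<close>) does not
  increase in expectation provided that \<open>w\<^sub>s\<^sub>+\<^sub>1 (1 - a\<^sup>(\<^sup>s\<^sup>+\<^sup>1\<^sup>)) \<le> w\<^sub>s\<close>, and the expected gap after
  \<open>s\<close> epochs is at most \<open>V / w\<^sub>s\<close>. For the given schedule \<open>w\<^sub>1 \<ge> sqrt n\<close>, the weight is at least
  \<open>n\<close> after the first phase, and it grows quadratically in the second.
\<close>

section \<open>Gradients on a coordinate subspace\<close>

text \<open>Lines in directions of \<open>E\<close> stay inside \<open>E\<close>, so the derivative
  within \<open>E\<close> restricts to an ordinary one-variable derivative. Uniqueness of the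
  gradient and both first-order inequalities reduce to this.\<close>

lemma has_real_derivative_along_line:
  fixes \<phi> :: "'a::real_inner \<Rightarrow> real"
  assumes E: "subspace E" "x \<in> E" "v \<in> E"
    and "(\<phi> has_derivative (\<lambda>w. g \<bullet> w)) (at (x + t *\<^sub>R v) within E)"
  shows "((\<lambda>s. \<phi> (x + s *\<^sub>R v)) has_real_derivative g \<bullet> v) (at t)"
proof -
  have *: "((\<lambda>s. x + s *\<^sub>R v) has_derivative (\<lambda>s. s *\<^sub>R v)) (at t)"
    by (auto intro!: derivative_eq_intros)
  have "range (\<lambda>s. x + s *\<^sub>R v) \<subseteq> E"
    using E by (auto intro: subspace_add subspace_scale)
  then have "(\<phi> has_derivative (\<lambda>w. g \<bullet> w)) (at (x + t *\<^sub>R v) within range (\<lambda>s. x + s *\<^sub>R v))"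
    using assms(4) has_derivative_subset by blast
  from has_derivative_in_compose[OF * this]
  have "((\<lambda>s. \<phi> (x + s *\<^sub>R v)) has_derivative (\<lambda>s. g \<bullet> (s *\<^sub>R v))) (at t)" .
  then show ?thesis
    unfolding has_field_derivative_def by (rule has_derivative_eq_rhs) (simp add: fun_eq_iff)
qed

text \<open>Two candidates differ by a vector \<open>v\<close> of \<open>euclid d\<close>, and both
  inner products with \<open>v\<close> equal the directional derivative along \<open>v\<close>;
  hence \<open>v \<bullet> v = 0\<close>.\<close>

lemma gradient_eqI:
  assumes x: "x \<in> euclid d" and g: "g \<in> euclid d"
    and der: "(\<phi> has_derivative (\<lambda>v. g \<bullet> v)) (at x within euclid d)"
  shows "gradient d \<phi> x = g"
  unfolding gradient_def
proof (rule the_equality)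
  fix g' assume g': "g' \<in> euclid d \<and> (\<phi> has_derivative (\<lambda>v. g' \<bullet> v)) (at x within euclid d)"
  define v where "v = g' - g"
  have v: "v \<in> euclid d" using g g' by (simp add: v_def subspace_diff subspace_euclid)
  have "g \<bullet> v = g' \<bullet> v"
    by (rule DERIV_unique[OF has_real_derivative_along_line[OF subspace_euclid x v, of \<phi> g 0]
          has_real_derivative_along_line[OF subspace_euclid x v, of \<phi> g' 0]])
       (use der g' in auto)
  then have "v \<bullet> v = 0" by (simp add: v_def inner_diff_left)
  then show "g' = g" by (simp add: v_def)
qed (use assms in auto)

definition basis_fvec :: "nat \<Rightarrow> fvec" where
  "basis_fvec i = Abs_fvec (\<lambda>j. if j = i then 1 else 0)"

lemma coord_basis_fvec [simp]: "coord (basis_fvec i) j = (if j = i then 1 else 0)"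
  unfolding basis_fvec_def by (subst coord_Abs) auto

lemma coord_sum: "coord (\<Sum>i\<in>A. v i) j = (\<Sum>i\<in>A. coord (v i) j)"
  by (induction A rule: infinite_finite_induct) auto

lemma euclid_basis_expansion:
  assumes "x \<in> euclid d"
  shows "x = (\<Sum>i<d. coord x i *\<^sub>R basis_fvec i)"
proof (rule fvec_eqI)
  fix j show "coord x j = coord (\<Sum>i<d. coord x i *\<^sub>R basis_fvec i) j"
    using assms by (cases "j < d") (auto simp: coord_sum euclid_def if_distrib not_less cong: if_cong)
qed

text \<open>Riesz representation: the values of the derivative on the basis vectors are the
  coordinates of the gradient, which makes the definite description in \<open>gradient\<close>
  meaningful.\<close>

lemma gradient_works:
  assumes x: "x \<in> euclid d" and diff: "\<phi> differentiable_on euclid d"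
  shows "gradient d \<phi> x \<in> euclid d"
    "(\<phi> has_derivative (\<lambda>v. gradient d \<phi> x \<bullet> v)) (at x within euclid d)"
proof -
  obtain L where L: "(\<phi> has_derivative L) (at x within euclid d)"
    using diff x by (auto simp: differentiable_on_def differentiable_def)
  define g where "g = (\<Sum>i<d. L (basis_fvec i) *\<^sub>R basis_fvec i)"
  have g: "g \<in> euclid d" by (auto simp: g_def euclid_def coord_sum)
  have cg: "coord g i = L (basis_fvec i)" if "i < d" for i
    using that by (simp add: g_def coord_sum if_distrib cong: if_cong)
  have Lg: "L v = g \<bullet> v" if "v \<in> euclid d" for v
  proof -
    interpret L: bounded_linear L using L by (rule has_derivative_bounded_linear)
    have "L v = (\<Sum>i<d. coord v i * L (basis_fvec i))"
      by (subst euclid_basis_expansion[OF that]) (simp add: L.sum L.scaleR)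
    also have "\<dots> = g \<bullet> v"
      using g cg by (auto simp: inner_euclid intro: sum.cong)
    finally show ?thesis .
  qed
  have "(\<phi> has_derivative (\<lambda>v. g \<bullet> v)) (at x within euclid d)"
    unfolding has_derivative_within
  proof (intro conjI)
    show "bounded_linear (\<lambda>v. g \<bullet> v)" by (rule bounded_linear_inner_right)
    \<comment> \<open>\<open>L\<close> and the inner product with \<open>g\<close> are known to
      agree only on \<open>euclid d\<close>, but the difference quotient within
      \<open>euclid d\<close> evaluates them only at \<open>y - x\<close>, which lies there.\<close>
    have "((\<lambda>y. (1 / norm (y - x)) *\<^sub>R (\<phi> y - (\<phi> x + L (y - x)))) \<longlongrightarrow> 0) (at x within euclid d)"
      using L by (simp add: has_derivative_within)
    moreover have "\<forall>\<^sub>F y in at x within euclid d.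
        (1 / norm (y - x)) *\<^sub>R (\<phi> y - (\<phi> x + L (y - x))) =
        (1 / norm (y - x)) *\<^sub>R (\<phi> y - (\<phi> x + g \<bullet> (y - x)))"
      using x by (auto simp: eventually_at_filter Lg subspace_diff subspace_euclid)
    ultimately show "((\<lambda>y. (1 / norm (y - x)) *\<^sub>R (\<phi> y - (\<phi> x + g \<bullet> (y - x)))) \<longlongrightarrow> 0)
        (at x within euclid d)"
      by (rule Lim_transform_eventually)
  qed
  then show "gradient d \<phi> x \<in> euclid d"
    "(\<phi> has_derivative (\<lambda>v. gradient d \<phi> x \<bullet> v)) (at x within euclid d)"
    using gradient_eqI[OF x g] g by auto
qed

lemma gradient_average:
  assumes x: "x \<in> euclid d" and diff: "\<And>i. i \<in> {1..n} \<Longrightarrow> f i differentiable_on euclid d"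
  shows "gradient d (average n f) x = (\<Sum>i=1..n. gradient d (f i) x) /\<^sub>R real n"
proof (rule gradient_eqI[OF x])
  show "(\<Sum>i=1..n. gradient d (f i) x) /\<^sub>R real n \<in> euclid d"
    by (intro subspace_scale subspace_sum subspace_euclid gradient_works x diff)
  have "((\<lambda>y. (\<Sum>i=1..n. f i y) / real n) has_derivative
      (\<lambda>v. (\<Sum>i=1..n. gradient d (f i) x \<bullet> v) / real n)) (at x within euclid d)"
    unfolding divide_inverse
    by (intro has_derivative_mult_left has_derivative_sum gradient_works x diff)
  then show "(average n f has_derivative
      (\<lambda>v. ((\<Sum>i=1..n. gradient d (f i) x) /\<^sub>R real n) \<bullet> v)) (at x within euclid d)"
    by (simp add: average_def [abs_def] inner_sum_left divide_inverse mult.commute)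
qed

section \<open>Smooth convex functions\<close>

locale smooth_convex =
  fixes E :: "'a::real_inner set" and \<phi> :: "'a \<Rightarrow> real" and G :: "'a \<Rightarrow> 'a" and \<beta> :: real
  assumes E: "subspace E"
    and \<beta>: "\<beta> > 0"
    and conv: "convex_on E \<phi>"
    and G_in: "x \<in> E \<Longrightarrow> G x \<in> E"
    and deriv: "x \<in> E \<Longrightarrow> (\<phi> has_derivative (\<lambda>v. G x \<bullet> v)) (at x within E)"
    and smooth: "x \<in> E \<Longrightarrow> y \<in> E \<Longrightarrow> norm (G x - G y) \<le> \<beta> * norm (x - y)"
begin

lemma tangent_below:
  assumes x: "x \<in> E" and y: "y \<in> E"
  shows "\<phi> x + G x \<bullet> (y - x) \<le> \<phi> y"
proof -
  \<comment> \<open>On the line through \<open>x\<close> and \<open>y\<close> the claim is that a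
    convex function of one variable lies above its tangent at 0, evaluated at 1.\<close>
  define p where "p = (\<lambda>t. \<phi> (x + t *\<^sub>R (y - x)))"
  have yx: "y - x \<in> E" using x y E by (simp add: subspace_diff)
  have line: "x + t *\<^sub>R (y - x) \<in> E" for t
    using x yx E by (simp add: subspace_add subspace_scale)
  have "convex_on UNIV p"
  proof (rule convex_onI)
    fix t s r :: real assume "0 < t" "t < 1"
    have "x + ((1 - t) * s + t * r) *\<^sub>R (y - x) =
        (1 - t) *\<^sub>R (x + s *\<^sub>R (y - x)) + t *\<^sub>R (x + r *\<^sub>R (y - x))"
      by (simp add: algebra_simps)
    then show "p ((1 - t) *\<^sub>R s + t *\<^sub>R r) \<le> (1 - t) * p s + t * p r"
      using convex_onD[OF conv, of t "x + s *\<^sub>R (y - x)" "x + r *\<^sub>R (y - x)"] line \<open>0 < t\<close> \<open>t < 1\<close>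
      by (simp add: p_def)
  qed simp
  moreover have "(p has_real_derivative G x \<bullet> (y - x)) (at 0)"
    unfolding p_def using has_real_derivative_along_line[OF E x yx, of \<phi> "G x" 0] deriv[OF x] by simp
  ultimately have "p 1 - p 0 \<ge> (G x \<bullet> (y - x)) * (1 - 0)"
    by (intro convex_on_imp_above_tangent[where A = UNIV]) auto
  then show ?thesis by (simp add: p_def)
qed

lemma quadratic_above:
  assumes x: "x \<in> E" and y: "y \<in> E"
  shows "\<phi> y \<le> \<phi> x + G x \<bullet> (y - x) + \<beta> / 2 * (norm (y - x))\<^sup>2"
proof -
  \<comment> \<open>Subtracting the linear and quadratic terms turns the claim into
    \<open>p 1 \<le> p 0\<close>; Cauchy-Schwarz and the Lipschitz gradient make the derivative of
    \<open>p\<close> nonpositive on \<open>[0, 1]\<close>.\<close>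
  define p where "p = (\<lambda>t. \<phi> (x + t *\<^sub>R (y - x)) - t * (G x \<bullet> (y - x)) - \<beta> / 2 * t\<^sup>2 * (norm (y - x))\<^sup>2)"
  have yx: "y - x \<in> E" using x y E by (simp add: subspace_diff)
  have line: "x + t *\<^sub>R (y - x) \<in> E" for t
    using x yx E by (simp add: subspace_add subspace_scale)
  have "p 1 \<le> p 0"
  proof (rule DERIV_nonpos_imp_nonincreasing[where f = p])
    fix t :: real assume t: "0 \<le> t" "t \<le> 1"
    define D where "D = G (x + t *\<^sub>R (y - x)) \<bullet> (y - x) - G x \<bullet> (y - x) - \<beta> * t * (norm (y - x))\<^sup>2"
    have "((\<lambda>t. t * (G x \<bullet> (y - x)) + \<beta> / 2 * t\<^sup>2 * (norm (y - x))\<^sup>2) has_real_derivative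
        G x \<bullet> (y - x) + \<beta> * t * (norm (y - x))\<^sup>2) (at t)"
      by (auto intro!: derivative_eq_intros)
    from DERIV_diff[OF has_real_derivative_along_line[OF E x yx deriv[OF line]] this]
    have "(p has_real_derivative D) (at t)" by (simp add: p_def D_def diff_diff_eq)
    moreover have "D \<le> 0"
    proof -
      have "(G (x + t *\<^sub>R (y - x)) - G x) \<bullet> (y - x) \<le> norm (G (x + t *\<^sub>R (y - x)) - G x) * norm (y - x)"
        by (rule norm_cauchy_schwarz)
      also have "\<dots> \<le> (\<beta> * norm ((x + t *\<^sub>R (y - x)) - x)) * norm (y - x)"
        by (intro mult_right_mono smooth line x) auto
      finally show ?thesis using t by (simp add: D_def inner_diff_left power2_eq_square mult_ac)
    qed
    ultimately show "\<exists>D. (p has_real_derivative D) (at t) \<and> D \<le> 0" by blast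
  qed simp
  then show ?thesis by (simp add: p_def)
qed

lemma cocoercive:
  assumes x: "x \<in> E" and u: "u \<in> E"
  shows "(norm (G x - G u))\<^sup>2 \<le> 2 * \<beta> * (\<phi> u - \<phi> x - G x \<bullet> (u - x))"
proof -
  \<comment> \<open>\<open>\<phi> - \<langle>G x, \<cdot>\<rangle>\<close> is minimal in \<open>x\<close>; compare with a gradient step of it from \<open>u\<close>.\<close>
  define w where "w = G u - G x"
  define z where "z = u - (1 / \<beta>) *\<^sub>R w"
  have z: "z \<in> E" using x u E G_in by (simp add: z_def w_def subspace_diff subspace_scale)
  have "\<phi> x + G x \<bullet> (z - x) \<le> \<phi> u + G u \<bullet> (z - u) + \<beta> / 2 * (norm (z - u))\<^sup>2"
    using tangent_below[OF x z] quadratic_above[OF u z] by linarith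
  moreover have "G x \<bullet> (z - x) = G x \<bullet> (u - x) + G x \<bullet> (z - u)" by (simp add: inner_diff_right)
  moreover have "G u \<bullet> (z - u) - G x \<bullet> (z - u) = - (norm w)\<^sup>2 / \<beta>"
    by (simp add: z_def w_def inner_diff_left power2_norm_eq_inner diff_divide_distrib)
  moreover have "\<beta> / 2 * (norm (z - u))\<^sup>2 = (norm w)\<^sup>2 / (2 * \<beta>)"
    using \<beta> by (simp add: z_def power_divide power2_eq_square)
  ultimately have "(norm w)\<^sup>2 / (2 * \<beta>) \<le> \<phi> u - \<phi> x - G x \<bullet> (u - x)"
    by (simp add: field_simps)
  then show ?thesis
    using \<beta> by (simp add: w_def norm_minus_commute field_simps)
qed

end

section \<open>Proximal inequality and variance of a finite sample\<close>

lemma norm_convex_combination: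
  fixes p r :: "'a::real_inner"
  shows "(norm ((1 - \<theta>) *\<^sub>R p + \<theta> *\<^sub>R r))\<^sup>2 =
    (1 - \<theta>) * (norm p)\<^sup>2 + \<theta> * (norm r)\<^sup>2 - \<theta> * (1 - \<theta>) * (norm (p - r))\<^sup>2"
  by (simp add: power2_norm_eq_inner inner_commute algebra_simps)

text \<open>Minimality is tested against points of the segment from \<open>z\<close> to
  \<open>y\<close>. Strong convexity of the squared distance leaves a factor
  \<open>1 - \<theta>\<close> on the term in \<open>norm (z - y)\<close>; dividing by
  \<open>\<theta>\<close> and letting it tend to 0 recovers the full term.\<close>

lemma prox_inequality:
  fixes X :: "'a::real_inner set"
  assumes "convex X" and h: "convex_on X h" and "L \<ge> 0"
    and z: "is_arg_min (\<lambda>z. g \<bullet> z + h z + L / 2 * (norm (z - x))\<^sup>2) (\<lambda>z. z \<in> X) z"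
    and y: "y \<in> X"
  shows "g \<bullet> (z - y) + h z - h y \<le>
    L / 2 * ((norm (x - y))\<^sup>2 - (norm (z - y))\<^sup>2 - (norm (z - x))\<^sup>2)"
proof -
  define A where "A = g \<bullet> (y - z) + h y - h z + L / 2 * ((norm (y - x))\<^sup>2 - (norm (z - x))\<^sup>2)"
  define B where "B = L / 2 * (norm (z - y))\<^sup>2"
  have zX: "z \<in> X" using z by (simp add: is_arg_min_def)
  have "(1 - \<theta>) * B \<le> A" if \<theta>: "0 < \<theta>" "\<theta> < 1" for \<theta>
  proof -
    define v where "v = (1 - \<theta>) *\<^sub>R z + \<theta> *\<^sub>R y"
    have "v \<in> X" using \<open>convex X\<close> zX y \<theta> by (simp add: v_def convexD)
    then have "g \<bullet> z + h z + L / 2 * (norm (z - x))\<^sup>2 \<le> g \<bullet> v + h v + L / 2 * (norm (v - x))\<^sup>2"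
      using z by (auto simp: is_arg_min_linorder)
    moreover have "h v \<le> (1 - \<theta>) * h z + \<theta> * h y"
      unfolding v_def using \<theta> zX y by (intro convex_onD[OF h]) auto
    moreover have "v - x = (1 - \<theta>) *\<^sub>R (z - x) + \<theta> *\<^sub>R (y - x)"
      by (simp add: v_def algebra_simps)
    then have "(norm (v - x))\<^sup>2 = (1 - \<theta>) * (norm (z - x))\<^sup>2 + \<theta> * (norm (y - x))\<^sup>2
        - \<theta> * (1 - \<theta>) * (norm (z - y))\<^sup>2"
      using norm_convex_combination[of \<theta> "z - x" "y - x"] by simp
    moreover have "g \<bullet> v = (1 - \<theta>) * (g \<bullet> z) + \<theta> * (g \<bullet> y)"
      by (simp add: v_def inner_add_right)
    ultimately have "g \<bullet> z + h z + L / 2 * (norm (z - x))\<^sup>2 \<le>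
        (1 - \<theta>) * (g \<bullet> z) + \<theta> * (g \<bullet> y) + ((1 - \<theta>) * h z + \<theta> * h y) +
        L / 2 * ((1 - \<theta>) * (norm (z - x))\<^sup>2 + \<theta> * (norm (y - x))\<^sup>2
          - \<theta> * (1 - \<theta>) * (norm (z - y))\<^sup>2)"
      by simp
    then have "\<theta> * ((1 - \<theta>) * B) \<le> \<theta> * A"
      by (simp add: A_def B_def inner_diff_right field_simps)
    then show ?thesis using \<theta> by simp
  qed
  then have "\<forall>\<^sub>F \<theta> in at_right 0. (1 - \<theta>) * B \<le> A"
    by (intro eventually_at_rightI[of 0 1]) auto
  moreover have "((\<lambda>\<theta>. (1 - \<theta>) * B) \<longlongrightarrow> (1 - 0) * B) (at_right 0)"
    by (intro tendsto_intros)
  ultimately have "(1 - 0) * B \<le> A"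
    by (intro tendsto_upperbound[where F = "at_right (0::real)"]) auto
  then show ?thesis
    by (simp add: A_def B_def inner_diff_right norm_minus_commute algebra_simps)
qed

text \<open>The variance is at most the second moment: they differ by \<open>card A\<close> times
  the squared norm of the mean.\<close>

lemma sum_norm_deviation_le:
  fixes v :: "'b \<Rightarrow> 'a::real_inner"
  assumes "finite A" "A \<noteq> {}"
  shows "(\<Sum>i\<in>A. (norm ((\<Sum>j\<in>A. v j) /\<^sub>R real (card A) - v i))\<^sup>2) \<le> (\<Sum>i\<in>A. (norm (v i))\<^sup>2)"
proof -
  define m where "m = (\<Sum>j\<in>A. v j) /\<^sub>R real (card A)"
  have m: "(\<Sum>j\<in>A. v j) = real (card A) *\<^sub>R m" using assms by (simp add: m_def)
  have "(\<Sum>i\<in>A. (norm (m - v i))\<^sup>2) =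
      real (card A) * (m \<bullet> m) - 2 * (m \<bullet> (\<Sum>i\<in>A. v i)) + (\<Sum>i\<in>A. v i \<bullet> v i)"
    by (simp add: power2_norm_eq_inner inner_diff_left inner_diff_right inner_commute sum.distrib
        sum_subtractf inner_sum_right sum_distrib_left)
  also have "\<dots> = (\<Sum>i\<in>A. (norm (v i))\<^sup>2) - real (card A) * (m \<bullet> m)"
    by (simp add: m power2_norm_eq_inner)
  finally show ?thesis by (simp add: m_def)
qed

section \<open>The step sizes\<close>

lemma next_gamma_ge:
  assumes "\<gamma> > 0"
  shows "\<gamma> \<le> next_gamma opt \<eta> \<gamma> x x'"
  using assms by (cases opt) (auto simp: mult_le_cancel_left1)

text \<open>Converts a squared step length into growth of the logarithm of \<open>\<gamma>\<close>
  under Option I. It is \<open>ln t \<le> t - 1\<close> at \<open>t = 1 / (1 + w)\<close>.\<close>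

lemma le_mult_ln_one_plus:
  fixes w W :: real
  assumes "0 \<le> w" "w \<le> W"
  shows "w \<le> (1 + W) * ln (1 + w)"
proof -
  have "w / (1 + w) \<le> ln (1 + w)"
    using assms ln_le_minus_one[of "1 / (1 + w)"] by (simp add: ln_div field_simps)
  then have "w \<le> (1 + w) * ln (1 + w)" using assms by (simp add: field_simps)
  also have "\<dots> \<le> (1 + W) * ln (1 + w)" using assms by (intro mult_right_mono) auto
  finally show ?thesis .
qed

text \<open>\<open>V_const\<close> is a potential: its last summand pays for all error terms
  \<open>(\<gamma>\<^sub>t - \<gamma>\<^sub>t\<^sub>-\<^sub>1) r\<^sub>t\<^sup>2 + (\<beta> - \<gamma>\<^sub>t\<^sub>-\<^sub>1) \<delta>\<^sub>t\<^sup>2\<close>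
  of the remaining iterations, which become nonpositive once \<open>\<gamma>\<close> is large.\<close>

lemma V_const_step_Option_I:
  fixes \<gamma> \<eta> D \<beta> \<delta> r r' :: real
  assumes \<gamma>: "\<gamma> > 0" and \<eta>: "\<eta> > 0" "2 * \<eta>\<^sup>2 > D\<^sup>2" and \<beta>: "\<beta> > 0"
    and \<delta>: "0 \<le> \<delta>" "\<delta> \<le> D" and r': "0 \<le> r'" "r' \<le> D"
    and \<gamma>': "\<gamma>' = \<gamma> * sqrt (1 + \<delta>\<^sup>2 / \<eta>\<^sup>2)"
  shows "\<gamma> * (r\<^sup>2 - r'\<^sup>2) + (\<beta> - \<gamma>) * \<delta>\<^sup>2 + V_const Option_I \<beta> \<gamma>' \<eta> D 0 r'
    \<le> V_const Option_I \<beta> \<gamma> \<eta> D 0 r"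
proof -
  \<comment> \<open>The growth of \<open>\<gamma>\<close> costs at most the fraction
    \<open>D^2 / (2 * \<eta>^2)\<close> of \<open>\<gamma> * \<delta>^2\<close>, which turns the
    coefficient \<open>\<beta> - \<gamma>\<close> into \<open>\<beta> - \<kappa> * \<gamma>\<close>.
    \<open>B = \<beta> / \<kappa>\<close> is where this coefficient changes sign.\<close>
  define \<kappa> where "\<kappa> = 1 - D\<^sup>2 / (2 * \<eta>\<^sup>2)"
  define B where "B = 2 * \<eta>\<^sup>2 * \<beta> / (2 * \<eta>\<^sup>2 - D\<^sup>2)"
  define w where "w = \<delta>\<^sup>2 / \<eta>\<^sup>2"
  have \<kappa>: "\<kappa> > 0" using \<eta> by (simp add: \<kappa>_def)
  have B: "B > 0" "\<kappa> * B = \<beta>"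
  proof -
    have "\<kappa> = (2 * \<eta>\<^sup>2 - D\<^sup>2) / (2 * \<eta>\<^sup>2)" using \<eta> by (simp add: \<kappa>_def diff_divide_distrib)
    then show "\<kappa> * B = \<beta>" using \<eta> by (simp add: B_def)
  qed (use \<eta> \<beta> in \<open>simp add: B_def\<close>)
  have w: "w \<ge> 0" "\<delta>\<^sup>2 = \<eta>\<^sup>2 * w" using \<eta> by (simp_all add: w_def)
  have \<delta>D: "\<delta>\<^sup>2 \<le> D\<^sup>2" and rD: "r'\<^sup>2 \<le> D\<^sup>2" using \<delta> r' by (auto intro: power_mono)
  have wD: "w \<le> D\<^sup>2 / \<eta>\<^sup>2" using \<delta>D by (simp add: w_def divide_right_mono)
  have ge: "\<gamma> \<le> \<gamma>'" using \<gamma> by (simp add: \<gamma>' mult_le_cancel_left1)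
  have "sqrt (1 + w) \<le> 1 + w / 2"
    using w by (intro real_le_lsqrt) (auto simp: power2_eq_square algebra_simps)
  then have "\<gamma>' - \<gamma> \<le> \<gamma> * (w / 2)"
    using \<gamma> mult_left_mono[of "sqrt (1 + w)" "1 + w / 2" \<gamma>] by (simp add: \<gamma>' w_def[symmetric] algebra_simps)
  then have "(\<gamma>' - \<gamma>) * r'\<^sup>2 \<le> \<gamma> * (w / 2) * D\<^sup>2"
    using rD ge w \<gamma> by (intro mult_mono) auto
  also have "\<dots> = \<gamma> * (D\<^sup>2 / (2 * \<eta>\<^sup>2)) * \<delta>\<^sup>2" by (simp add: w_def mult_ac)
  finally have err: "(\<gamma>' - \<gamma>) * r'\<^sup>2 + (\<beta> - \<gamma>) * \<delta>\<^sup>2 \<le> (\<beta> - \<kappa> * \<gamma>) * \<delta>\<^sup>2"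
    by (simp add: \<kappa>_def algebra_simps)
  define R where "R g = max (\<beta> - \<kappa> * g) 0 * (D\<^sup>2 + 2 * (\<eta>\<^sup>2 + D\<^sup>2) * ln (B / g))" for g
  have "(\<beta> - \<kappa> * \<gamma>) * \<delta>\<^sup>2 + R \<gamma>' \<le> R \<gamma>"
  proof (cases "\<gamma> < B")
    case False
    have "\<beta> - \<kappa> * g \<le> 0" if "g \<ge> B" for g
      using mult_left_mono[OF that, of \<kappa>] \<kappa> B by simp
    then show ?thesis using False ge by (simp add: R_def mult_nonpos_nonneg)
  next
    case True
    then have pos: "\<beta> - \<kappa> * \<gamma> > 0" using \<kappa> B by (simp flip: B(2))
    then have R_eq: "R \<gamma> = (\<beta> - \<kappa> * \<gamma>) * (D\<^sup>2 + 2 * (\<eta>\<^sup>2 + D\<^sup>2) * ln (B / \<gamma>))"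
      by (simp add: R_def)
    have ln0: "ln (B / \<gamma>) \<ge> 0" using True \<gamma> by simp
    show ?thesis
    \<comment> \<open>In the step that crosses \<open>B\<close> the summand \<open>D^2\<close> of
      the potential pays for \<open>\<delta>^2\<close>; before that, the drop of the logarithm by
      half of \<open>ln (1 + w)\<close> does.\<close>
    proof (cases "\<gamma>' < B")
      case False
      then have "R \<gamma>' = 0" using mult_left_mono[of B \<gamma>' \<kappa>] \<kappa> B by (simp add: R_def)
      moreover have "(\<beta> - \<kappa> * \<gamma>) * \<delta>\<^sup>2 \<le> (\<beta> - \<kappa> * \<gamma>) * (D\<^sup>2 + 2 * (\<eta>\<^sup>2 + D\<^sup>2) * ln (B / \<gamma>))"
        using pos \<delta>D ln0 by (intro mult_left_mono) (auto intro: add_increasing2)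
      ultimately show ?thesis by (simp only: R_eq add_0_right)
    next
      case lt: True
      have ln': "ln (B / \<gamma>') \<ge> 0" using lt ge \<gamma> by simp
      have pos': "\<beta> - \<kappa> * \<gamma>' > 0" using lt \<kappa> by (simp flip: B(2))
      have "ln (B / \<gamma>) = ln (B / \<gamma>') + ln (1 + w) / 2"
        using \<gamma> B w(1) by (simp add: \<gamma>' w_def[symmetric] ln_div ln_mult ln_sqrt)
      moreover have "\<delta>\<^sup>2 \<le> (\<eta>\<^sup>2 + D\<^sup>2) * ln (1 + w)"
      proof -
        have "\<delta>\<^sup>2 \<le> \<eta>\<^sup>2 * ((1 + D\<^sup>2 / \<eta>\<^sup>2) * ln (1 + w))"
          unfolding w(2) using le_mult_ln_one_plus[OF w(1) wD] by (intro mult_left_mono) auto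
        then show ?thesis using \<eta> by (simp add: algebra_simps)
      qed
      ultimately have step: "\<delta>\<^sup>2 + 2 * (\<eta>\<^sup>2 + D\<^sup>2) * ln (B / \<gamma>') \<le> 2 * (\<eta>\<^sup>2 + D\<^sup>2) * ln (B / \<gamma>)"
        by (simp add: algebra_simps)
      have "R \<gamma>' \<le> (\<beta> - \<kappa> * \<gamma>) * (D\<^sup>2 + 2 * (\<eta>\<^sup>2 + D\<^sup>2) * ln (B / \<gamma>'))"
        unfolding R_def using pos pos' \<kappa> ge ln' by (intro mult_right_mono) auto
      then have "(\<beta> - \<kappa> * \<gamma>) * \<delta>\<^sup>2 + R \<gamma>' \<le>
          (\<beta> - \<kappa> * \<gamma>) * (D\<^sup>2 + (\<delta>\<^sup>2 + 2 * (\<eta>\<^sup>2 + D\<^sup>2) * ln (B / \<gamma>')))"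
        by (simp add: algebra_simps)
      also have "\<dots> \<le> (\<beta> - \<kappa> * \<gamma>) * (D\<^sup>2 + 2 * (\<eta>\<^sup>2 + D\<^sup>2) * ln (B / \<gamma>))"
        using pos step by (intro mult_left_mono) auto
      finally show ?thesis by (simp only: R_eq)
    qed
  qed
  moreover have "V_const Option_I \<beta> g \<eta> D 0 \<rho> = g * \<rho>\<^sup>2 + R g" for g \<rho>
    by (simp add: R_def \<kappa>_def B_def)
  ultimately show ?thesis using err by (simp add: algebra_simps del: V_const.simps)
qed

text \<open>The update is additive, so no logarithm arises: the errors
  \<open>(A - \<gamma>) * w\<close> over increments \<open>w\<close> of \<open>\<gamma>\<close> are
  paid by the quadratic \<open>R\<close>.\<close>

lemma V_const_step_Option_II:
  fixes \<gamma> \<eta> D \<beta> \<delta> r r' :: real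
  assumes \<eta>: "\<eta> > 0" and \<delta>: "0 \<le> \<delta>" "\<delta> \<le> D" and r': "0 \<le> r'" "r' \<le> D"
    and \<gamma>': "\<gamma>' = \<gamma> + \<delta>\<^sup>2 / \<eta>\<^sup>2"
  shows "\<gamma> * (r\<^sup>2 - r'\<^sup>2) + (\<beta> - \<gamma>) * \<delta>\<^sup>2 + V_const Option_II \<beta> \<gamma>' \<eta> D 0 r'
    \<le> V_const Option_II \<beta> \<gamma> \<eta> D 0 r"
proof -
  define W where "W = D\<^sup>2 / \<eta>\<^sup>2"
  define A where "A = W + \<beta>"
  define w where "w = \<delta>\<^sup>2 / \<eta>\<^sup>2"
  have w: "w \<ge> 0" "\<delta>\<^sup>2 = \<eta>\<^sup>2 * w" "\<gamma>' = \<gamma> + w" using \<eta> by (simp_all add: w_def \<gamma>')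
  have \<delta>D: "\<delta>\<^sup>2 \<le> D\<^sup>2" and rD: "r'\<^sup>2 \<le> D\<^sup>2" using \<delta> r' by (auto intro: power_mono)
  have wW: "w \<le> W" using \<delta>D by (simp add: w_def W_def divide_right_mono)
  have "(\<gamma>' - \<gamma>) * r'\<^sup>2 \<le> w * D\<^sup>2" using w rD by (intro mult_mono) auto
  also have "\<dots> = W * \<delta>\<^sup>2" by (simp add: w_def W_def)
  finally have err: "(\<gamma>' - \<gamma>) * r'\<^sup>2 + (\<beta> - \<gamma>) * \<delta>\<^sup>2 \<le> \<eta>\<^sup>2 * ((A - \<gamma>) * w)"
    using w(2) by (simp add: A_def algebra_simps)
  define R where "R g = max (A - g) 0 * (A + W - g)" for g
  have "(A - \<gamma>) * w + R \<gamma>' \<le> R \<gamma>"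
  proof (cases "\<gamma> < A")
    case False
    then show ?thesis using w by (simp add: R_def mult_nonpos_nonneg)
  next
    case True
    \<comment> \<open>Decrease of the second factor alone suffices. Its summand \<open>W\<close>
      keeps it nonnegative even if \<open>\<gamma>'\<close> has passed \<open>A\<close>, because one
      increment \<open>w\<close> is at most \<open>W\<close>.\<close>
    have "R \<gamma>' \<le> (A - \<gamma>) * (A + W - \<gamma>')"
      unfolding R_def using True w wW by (intro mult_right_mono) auto
    then show ?thesis using True w by (simp add: R_def algebra_simps)
  qed
  then have "\<eta>\<^sup>2 * ((A - \<gamma>) * w) + \<eta>\<^sup>2 * R \<gamma>' \<le> \<eta>\<^sup>2 * R \<gamma>"
    by (simp flip: distrib_left add: mult_left_mono)
  moreover have "V_const Option_II \<beta> g \<eta> D 0 \<rho> = g * \<rho>\<^sup>2 + \<eta>\<^sup>2 * R g" for g \<rho>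
    by (simp add: R_def A_def W_def mult.assoc algebra_simps)
  ultimately show ?thesis using err by (simp add: algebra_simps del: V_const.simps)
qed

lemma V_const_step:
  fixes x x' z :: fvec
  assumes "\<gamma> > 0" "\<eta> > 0" "opt = Option_I \<longrightarrow> 2 * \<eta>\<^sup>2 > D\<^sup>2" "\<beta> > 0"
    and "norm (x' - x) \<le> D" "norm (x' - z) \<le> D"
  shows "\<gamma> * ((norm (x - z))\<^sup>2 - (norm (x' - z))\<^sup>2) + (\<beta> - \<gamma>) * (norm (x' - x))\<^sup>2 +
      V_const opt \<beta> (next_gamma opt \<eta> \<gamma> x x') \<eta> D 0 (norm (x' - z))
    \<le> V_const opt \<beta> \<gamma> \<eta> D 0 (norm (x - z))"
proof (cases opt)
  case Option_I
  with assms show ?thesis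
    unfolding Option_I by (intro V_const_step_Option_I) auto
next
  case Option_II
  with assms show ?thesis
    unfolding Option_II by (intro V_const_step_Option_II) auto
qed

lemma V_const_split: "V_const opt \<beta> \<gamma> \<eta> D \<Delta> r = \<Delta> / 2 + V_const opt \<beta> \<gamma> \<eta> D 0 r"
  by (cases opt) auto

text \<open>Allows the final potential to be dropped. When the factor with \<open>max\<close> is
  positive, \<open>\<gamma>\<close> is still too small for the other factor to be negative.\<close>

lemma V_const_nonneg:
  assumes "\<gamma> > 0" "opt = Option_I \<longrightarrow> 2 * \<eta>\<^sup>2 > D\<^sup>2"
  shows "0 \<le> V_const opt \<beta> \<gamma> \<eta> D 0 r"
proof (cases opt)
  case Option_I
  define \<kappa> B where "\<kappa> = 1 - D\<^sup>2 / (2 * \<eta>\<^sup>2)" and "B = 2 * \<eta>\<^sup>2 * \<beta> / (2 * \<eta>\<^sup>2 - D\<^sup>2)"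
  have "0 \<le> max (\<beta> - \<kappa> * \<gamma>) 0 * (D\<^sup>2 + 2 * (\<eta>\<^sup>2 + D\<^sup>2) * ln (B / \<gamma>))"
  proof (cases "\<beta> - \<kappa> * \<gamma> > 0")
    case True
    have \<eta>: "2 * \<eta>\<^sup>2 > D\<^sup>2" using assms Option_I by simp
    then have "\<eta> \<noteq> 0" by (auto simp: not_less)
    then have "B / \<gamma> \<ge> 1" using True \<eta> \<open>\<gamma> > 0\<close> by (simp add: \<kappa>_def B_def field_simps)
    then have "ln (B / \<gamma>) \<ge> 0" by simp
    then show ?thesis by (intro mult_nonneg_nonneg add_nonneg_nonneg) auto
  qed (simp add: max_def)
  then show ?thesis using assms Option_I by (simp add: \<kappa>_def B_def add_nonneg_nonneg)
next
  case Option_II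
  have "0 \<le> max (D\<^sup>2 / \<eta>\<^sup>2 + \<beta> - \<gamma>) 0 * (2 * D\<^sup>2 / \<eta>\<^sup>2 + \<beta> - \<gamma>)"
  proof (cases "D\<^sup>2 / \<eta>\<^sup>2 + \<beta> - \<gamma> > 0")
    case True
    moreover have "0 \<le> D\<^sup>2 / \<eta>\<^sup>2" "2 * D\<^sup>2 / \<eta>\<^sup>2 = D\<^sup>2 / \<eta>\<^sup>2 + D\<^sup>2 / \<eta>\<^sup>2" by simp_all
    ultimately have "0 \<le> 2 * D\<^sup>2 / \<eta>\<^sup>2 + \<beta> - \<gamma>" by linarith
    then show ?thesis by (intro mult_nonneg_nonneg) auto
  qed (simp add: max_def)
  then show ?thesis using assms Option_II by (simp add: mult.assoc add_nonneg_nonneg)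
qed

section \<open>Analysis of the algorithm\<close>

lemma convex_on_sum_fun:
  assumes "convex C" "\<And>i. i \<in> I \<Longrightarrow> convex_on C (\<lambda>x. f i x)"
  shows "convex_on C (\<lambda>x. \<Sum>i\<in>I. f i x)"
  using assms(2)
  by (induction I rule: infinite_finite_induct) (auto simp: convex_on_const assms(1))

text \<open>Tower rule with finite supports, so expectations are finite sums. It lifts a bound
  conditional on the current state to the whole run.\<close>

lemma expectation_bind_le:
  fixes \<phi> :: "'b \<Rightarrow> real"
  assumes fin: "finite (set_pmf p)" "\<And>x. x \<in> set_pmf p \<Longrightarrow> finite (set_pmf (k x))"
    and le: "\<And>x. x \<in> set_pmf p \<Longrightarrow> measure_pmf.expectation (k x) \<phi> \<le> \<psi> x"
  shows "measure_pmf.expectation (p \<bind> k) \<phi> \<le> measure_pmf.expectation p \<psi>"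
proof -
  have "measure_pmf.expectation (p \<bind> k) \<phi> =
      (\<Sum>x\<in>set_pmf p. pmf p x *\<^sub>R measure_pmf.expectation (k x) \<phi>)"
    using fin by (intro pmf_expectation_bind) auto
  also have "\<dots> \<le> (\<Sum>x\<in>set_pmf p. pmf p x *\<^sub>R \<psi> x)"
    using le by (intro sum_mono) (auto intro: mult_left_mono)
  also have "\<dots> = measure_pmf.expectation p \<psi>"
    using fin by (intro integral_measure_pmf[symmetric]) auto
  finally show ?thesis .
qed

locale adavrag_setting =
  fixes n d :: nat and X :: "fvec set" and f :: "nat \<Rightarrow> fvec \<Rightarrow> real" and h :: "fvec \<Rightarrow> real"
    and \<beta> :: real and z :: fvec and opt :: step_option and \<eta> D :: real
  assumes problem: "composite_problem n d X f h \<beta>"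
    and z: "is_arg_min (objective n f h) (\<lambda>x. x \<in> X) z"
    and diam: "x \<in> X \<Longrightarrow> y \<in> X \<Longrightarrow> norm (x - y) \<le> D"
    and \<eta>: "\<eta> > 0" "opt = Option_I \<longrightarrow> 2 * \<eta>\<^sup>2 > D\<^sup>2"
begin

abbreviation "F \<equiv> objective n f h"
abbreviation "gap x \<equiv> F x - F z"
abbreviation "potential \<gamma> x \<equiv> V_const opt \<beta> \<gamma> \<eta> D 0 (norm (x - z))"

text \<open>The proximal point as a function of the sampled index: with the state fixed, an
  expectation over the sample becomes an average over \<open>i\<close>.\<close>

definition step_point :: "real \<Rightarrow> real \<Rightarrow> fvec \<Rightarrow> fvec \<Rightarrow> real \<Rightarrow> nat \<Rightarrow> fvec" where
  "step_point a q u x \<gamma> i =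
     arg_min_on (\<lambda>v. (gradient d (f i) (a *\<^sub>R x + (1 - a) *\<^sub>R u) - gradient d (f i) u
       + gradient d (average n f) u) \<bullet> v + h v + \<gamma> * q / 2 * (norm (v - x))\<^sup>2) X"

lemma n: "n \<ge> 1" and \<beta>: "\<beta> > 0" and X_euclid: "X \<subseteq> euclid d" and convex_X: "convex X"
  and convex_h: "convex_on X h"
  and f_differentiable: "i \<in> {1..n} \<Longrightarrow> f i differentiable_on euclid d"
  using problem by (auto simp: composite_problem_def)

lemma z_in: "z \<in> X" and gap_nonneg: "x \<in> X \<Longrightarrow> 0 \<le> gap x"
  using z by (auto simp: is_arg_min_linorder)

lemma smooth_convex_component:
  assumes "i \<in> {1..n}"
  shows "smooth_convex (euclid d) (f i) (gradient d (f i)) \<beta>"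
  using assms problem gradient_works
  by unfold_locales (auto simp: composite_problem_def subspace_euclid)

section \<open>The averaged component functions and the gradient estimate\<close>

lemma sum_components: "(\<Sum>i=1..n. f i x) = real n * average n f x"
  using n by (simp add: average_def)

lemma gradient_average_eq:
  assumes "x \<in> euclid d"
  shows "gradient d (average n f) x = (\<Sum>i=1..n. gradient d (f i) x) /\<^sub>R real n"
  by (intro gradient_average assms f_differentiable)

lemma sum_gradients:
  assumes "x \<in> euclid d"
  shows "(\<Sum>i=1..n. gradient d (f i) x) = real n *\<^sub>R gradient d (average n f) x"
  using n gradient_average_eq[OF assms] by simp

lemma sum_gradients_inner:
  assumes "x \<in> euclid d"
  shows "(\<Sum>i=1..n. gradient d (f i) x \<bullet> v) = real n * (gradient d (average n f) x \<bullet> v)"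
  using sum_gradients[OF assms] by (simp flip: inner_sum_left)

lemma average_below_tangents:
  assumes x: "x \<in> euclid d" and v: "v \<in> euclid d"
  shows "average n f x + gradient d (average n f) x \<bullet> (v - x) \<le> average n f v"
proof -
  have "(\<Sum>i=1..n. f i x + gradient d (f i) x \<bullet> (v - x)) \<le> (\<Sum>i=1..n. f i v)"
    by (intro sum_mono smooth_convex.tangent_below[OF smooth_convex_component] x v)
  then have "real n * (average n f x + gradient d (average n f) x \<bullet> (v - x))
      \<le> real n * average n f v"
    by (simp only: sum.distrib sum_components sum_gradients_inner[OF x] distrib_left)
  then show ?thesis using n by simp
qed

lemma average_above:
  assumes x: "x \<in> euclid d" and v: "v \<in> euclid d"
  shows "average n f v \<le>
    average n f x + gradient d (average n f) x \<bullet> (v - x) + \<beta> / 2 * (norm (v - x))\<^sup>2"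
proof -
  have "(\<Sum>i=1..n. f i v) \<le>
      (\<Sum>i=1..n. f i x + gradient d (f i) x \<bullet> (v - x) + \<beta> / 2 * (norm (v - x))\<^sup>2)"
    by (intro sum_mono smooth_convex.quadratic_above[OF smooth_convex_component] x v)
  also have "\<dots> = real n *
      (average n f x + gradient d (average n f) x \<bullet> (v - x) + \<beta> / 2 * (norm (v - x))\<^sup>2)"
    by (simp only: sum.distrib sum_components sum_gradients_inner[OF x] distrib_left) simp
  finally show ?thesis using n by (simp only: sum_components mult_le_cancel_left_pos of_nat_0_less_iff)
qed

lemma variance_bound:
  assumes x: "x \<in> euclid d" and u: "u \<in> euclid d"
  defines "e \<equiv> \<lambda>i. gradient d (average n f) x -
    (gradient d (f i) x - gradient d (f i) u + gradient d (average n f) u)"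
  shows "(\<Sum>i=1..n. (norm (e i))\<^sup>2) \<le>
    real n * (2 * \<beta> * (average n f u - average n f x - gradient d (average n f) x \<bullet> (u - x)))"
proof -
  define v where "v i = gradient d (f i) x - gradient d (f i) u" for i
  have "(\<Sum>j\<in>{1..n}. v j) = real n *\<^sub>R (gradient d (average n f) x - gradient d (average n f) u)"
    by (simp only: v_def sum_subtractf sum_gradients[OF x] sum_gradients[OF u] scaleR_diff_right)
  \<comment> \<open>The estimate is unbiased, so \<open>e i\<close> is a deviation of
    \<open>v i\<close> from its mean; dropping the mean leaves gradient differences, to which
    cocoercivity applies.\<close>
  then have "e i = (\<Sum>j\<in>{1..n}. v j) /\<^sub>R real (card {1..n}) - v i" for i
    using n by (simp add: e_def v_def)
  then have "(\<Sum>i=1..n. (norm (e i))\<^sup>2) \<le> (\<Sum>i=1..n. (norm (v i))\<^sup>2)"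
    using sum_norm_deviation_le[of "{1..n}" v] n by simp
  also have "\<dots> \<le> (\<Sum>i=1..n. 2 * \<beta> * (f i u - f i x - gradient d (f i) x \<bullet> (u - x)))"
    unfolding v_def
    by (intro sum_mono smooth_convex.cocoercive[OF smooth_convex_component] x u)
  also have "\<dots> = 2 * \<beta> * (real n * average n f u - real n * average n f x
      - real n * (gradient d (average n f) x \<bullet> (u - x)))"
    by (simp only: sum_distrib_left[symmetric] sum_subtractf sum_components sum_gradients_inner[OF x])
  finally show ?thesis by (simp add: algebra_simps)
qed

lemma gradient_average_in:
  assumes "x \<in> euclid d"
  shows "gradient d (average n f) x \<in> euclid d"
  unfolding gradient_average_eq[OF assms]
  by (intro subspace_scale subspace_sum subspace_euclid gradient_works(1) assms f_differentiable)

text \<open>\<open>arg_min_on\<close> is a choice operator, so a minimizer has to be exhibited.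
  Completing the square turns the problem into the one with \<open>l = 1 / L\<close> and centre
  \<open>x - g / L\<close>, which is solvable by assumption.\<close>

lemma arg_min_on_prox:
  assumes g: "g \<in> euclid d" and x: "x \<in> X" and L: "L > 0"
  defines "\<psi> \<equiv> \<lambda>v. g \<bullet> v + h v + L / 2 * (norm (v - x))\<^sup>2"
  shows "is_arg_min \<psi> (\<lambda>v. v \<in> X) (arg_min_on \<psi> X)"
proof -
  define c where "c = x - (1 / L) *\<^sub>R g"
  have "c \<in> euclid d"
    using g x X_euclid by (auto simp: c_def intro!: subspace_diff subspace_scale subspace_euclid)
  then obtain v where v: "is_arg_min (\<lambda>v. (1 / L) * h v + (1/2) * (norm (v - c))\<^sup>2) (\<lambda>v. v \<in> X) v"
    using problem L unfolding composite_problem_def by (meson divide_nonneg_nonneg less_imp_le zero_le_one)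
  have "\<psi> w = L * ((1 / L) * h w + (1/2) * (norm (w - c))\<^sup>2) + (g \<bullet> x - (norm g)\<^sup>2 / (2 * L))" for w
  proof -
    have eq: "w - c = (w - x) + (1 / L) *\<^sub>R g" by (simp add: c_def)
    have "(norm (w - c))\<^sup>2 = (norm (w - x))\<^sup>2 + 2 / L * (g \<bullet> (w - x)) + (norm g)\<^sup>2 / L\<^sup>2"
      unfolding eq power2_norm_eq_inner inner_add_left inner_add_right inner_scaleR_left
        inner_scaleR_right inner_commute[of "w - x" g]
      using L by (simp add: power2_eq_square field_simps)
    then have "L / 2 * (norm (w - c))\<^sup>2 =
        L / 2 * (norm (w - x))\<^sup>2 + g \<bullet> (w - x) + (norm g)\<^sup>2 / (2 * L)"
      using L by (simp add: distrib_left power2_eq_square)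
    moreover have "L * ((1 / L) * h w + (1/2) * (norm (w - c))\<^sup>2) = h w + L / 2 * (norm (w - c))\<^sup>2"
      using L by (simp add: distrib_left)
    ultimately show ?thesis
      unfolding \<psi>_def inner_diff_right by linarith
  qed
  then have "is_arg_min \<psi> (\<lambda>v. v \<in> X) v"
    using v L by (simp add: is_arg_min_linorder)
  then show ?thesis
    unfolding arg_min_on_def arg_min_def by (rule someI)
qed

lemma average_point_in:
  assumes "x \<in> X" "u \<in> X" "0 < a" "a < 1"
  shows "a *\<^sub>R x + (1 - a) *\<^sub>R u \<in> X"
  using assms by (intro convexD[OF convex_X]) auto

lemma step_point_arg_min:
  assumes "i \<in> {1..n}" "x \<in> X" "u \<in> X" "\<gamma> > 0" "0 < a" "a < 1" "q > 0"
  shows "is_arg_min (\<lambda>v. (gradient d (f i) (a *\<^sub>R x + (1 - a) *\<^sub>R u) - gradient d (f i) u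
       + gradient d (average n f) u) \<bullet> v + h v + \<gamma> * q / 2 * (norm (v - x))\<^sup>2)
     (\<lambda>v. v \<in> X) (step_point a q u x \<gamma> i)"
proof -
  define xb where "xb = a *\<^sub>R x + (1 - a) *\<^sub>R u"
  have "xb \<in> euclid d" "u \<in> euclid d"
    using assms average_point_in X_euclid by (auto simp: xb_def)
  then have "gradient d (f i) xb - gradient d (f i) u + gradient d (average n f) u \<in> euclid d"
    using assms(1)
    by (intro subspace_add[OF subspace_euclid] subspace_diff[OF subspace_euclid]
        gradient_average_in gradient_works(1) f_differentiable)
  then show ?thesis
    unfolding step_point_def xb_def [symmetric] using assms by (intro arg_min_on_prox) auto
qed

lemma step_point_in:
  assumes "i \<in> {1..n}" "x \<in> X" "u \<in> X" "\<gamma> > 0" "0 < a" "a < 1" "q > 0"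
  shows "step_point a q u x \<gamma> i \<in> X"
  using step_point_arg_min[OF assms] by (simp add: is_arg_min_def)

text \<open>One inner iteration, averaged over the sampled index. The gradient error in direction
  \<open>z - x\<close> averages out, as that direction is independent of the sample; the error in
  the new step does not, and is the source of the variance term.\<close>

lemma step_bound:
  assumes x: "x \<in> X" and u: "u \<in> X" and \<gamma>: "\<gamma> > 0" and a: "0 < a" "a < 1" and q: "q > 0"
    and aq: "a * (2 - a) \<le> (1 - a) * q"
  defines "x' \<equiv> step_point a q u x \<gamma>"
  shows "(\<Sum>i=1..n. gap (a *\<^sub>R x' i + (1 - a) *\<^sub>R u) +
      a * q / 2 * potential (next_gamma opt \<eta> \<gamma> x (x' i)) (x' i)) / real n
    \<le> (1 - a) * gap u + a * q / 2 * potential \<gamma> x"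
proof -
  define xb where "xb = a *\<^sub>R x + (1 - a) *\<^sub>R u"
  define G where "G = gradient d (average n f) xb"
  define g where "g i = gradient d (f i) xb - gradient d (f i) u + gradient d (average n f) u" for i
  define e where "e i = G - g i" for i
  define B where "B = average n f u - average n f xb - G \<bullet> (u - xb)"
  have xb: "xb \<in> X" using average_point_in[OF x u a] by (simp add: xb_def)
  have x'X: "x' i \<in> X" if "i \<in> {1..n}" for i
    using that x u \<gamma> a q by (simp add: x'_def step_point_in)
  have single: "gap (a *\<^sub>R x' i + (1 - a) *\<^sub>R u) +
      a * q / 2 * potential (next_gamma opt \<eta> \<gamma> x (x' i)) (x' i) \<le>
      average n f xb + a * (g i \<bullet> (z - x)) + a * h z + (1 - a) * h u - F z
      + (1 - a) / (2 * \<beta>) * (norm (e i))\<^sup>2 + a * q / 2 * potential \<gamma> x"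
    (is "?l \<le> _") if i: "i \<in> {1..n}" for i
  proof -
    define \<delta> where "\<delta> = x' i - x"
    define xb' where "xb' = a *\<^sub>R x' i + (1 - a) *\<^sub>R u"
    have \<delta>: "xb' - xb = a *\<^sub>R \<delta>" by (simp add: xb'_def xb_def \<delta>_def algebra_simps)
    have xb': "xb' \<in> X" using average_point_in[OF x'X[OF i] u a] by (simp add: xb'_def)
    have 1: "average n f xb' \<le> average n f xb + a * (G \<bullet> \<delta>) + \<beta> * a\<^sup>2 / 2 * (norm \<delta>)\<^sup>2"
      using average_above[of xb xb'] xb xb' X_euclid a unfolding \<delta>
      by (auto simp: G_def power_mult_distrib mult_ac)
    have 2: "a * (e i \<bullet> \<delta>) \<le> (1 - a) / (2 * \<beta>) * (norm (e i))\<^sup>2 + a\<^sup>2 * \<beta> / (2 * (1 - a)) * (norm \<delta>)\<^sup>2"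
    proof -
      \<comment> \<open>This weight in Young's inequality makes the variance bound
        \<open>2 * \<beta> * B\<close> contribute exactly \<open>(1 - a) * B\<close>, the slack
        available at the end.\<close>
      define s where "s = (1 - a) / \<beta>"
      have s: "s > 0" using a \<beta> by (simp add: s_def)
      have "0 \<le> (norm (s *\<^sub>R e i - a *\<^sub>R \<delta>))\<^sup>2 / (2 * s)" using s by simp
      also have "\<dots> = s / 2 * (norm (e i))\<^sup>2 + a\<^sup>2 / (2 * s) * (norm \<delta>)\<^sup>2 - a * (e i \<bullet> \<delta>)"
        unfolding power2_norm_eq_inner inner_diff_left inner_diff_right inner_scaleR_left
          inner_scaleR_right inner_commute[of \<delta> "e i"]
        using s by (simp add: power2_eq_square field_simps)
      finally show ?thesis using \<beta> a by (simp add: s_def field_simps)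
    qed
    have 3: "g i \<bullet> (x' i - z) + h (x' i) - h z \<le>
        \<gamma> * q / 2 * ((norm (x - z))\<^sup>2 - (norm (x' i - z))\<^sup>2 - (norm \<delta>)\<^sup>2)"
      unfolding \<delta>_def x'_def g_def xb_def
      using step_point_arg_min[OF i x u \<gamma> a q] \<gamma> q
      by (intro prox_inequality[OF convex_X convex_h _ _ z_in]) auto
    have 4: "h xb' \<le> a * h (x' i) + (1 - a) * h u"
      using convex_onD[OF convex_h, of a u "x' i"] u x'X[OF i] a by (simp add: xb'_def add.commute)
    have 5: "\<gamma> * ((norm (x - z))\<^sup>2 - (norm (x' i - z))\<^sup>2) + (\<beta> - \<gamma>) * (norm \<delta>)\<^sup>2 +
        potential (next_gamma opt \<eta> \<gamma> x (x' i)) (x' i) \<le> potential \<gamma> x"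
      unfolding \<delta>_def using x x'X[OF i] z_in \<beta> \<eta> \<gamma> by (intro V_const_step diam) auto
    \<comment> \<open>The left side collects the smoothness and Young coefficients of the squared
      step. That the \<open>\<beta>\<close> part of the potential inequality covers them is
      precisely \<open>aq\<close>.\<close>
    have 6: "\<beta> * a\<^sup>2 / 2 + a\<^sup>2 * \<beta> / (2 * (1 - a)) \<le> a * q / 2 * \<beta>"
    proof -
      have "\<beta> * a\<^sup>2 / 2 + a\<^sup>2 * \<beta> / (2 * (1 - a)) = a * \<beta> / 2 * (a * (2 - a) / (1 - a))"
        using a by (simp add: field_simps power2_eq_square)
      also have "\<dots> \<le> a * \<beta> / 2 * q"
        using a \<beta> aq by (intro mult_left_mono) (auto simp: divide_le_eq mult.commute)
      finally show ?thesis by (simp add: mult_ac)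
    qed
    have eq: "G \<bullet> \<delta> = g i \<bullet> (x' i - z) + g i \<bullet> (z - x) + e i \<bullet> \<delta>"
      by (simp add: e_def \<delta>_def algebra_simps)
    have "a * (G \<bullet> \<delta>) = a * (g i \<bullet> (x' i - z)) + a * (g i \<bullet> (z - x)) + a * (e i \<bullet> \<delta>)"
      unfolding eq by (simp only: distrib_left)
    moreover have "a * (g i \<bullet> (x' i - z)) + a * h (x' i) - a * h z \<le>
        a * q / 2 * (\<gamma> * ((norm (x - z))\<^sup>2 - (norm (x' i - z))\<^sup>2) - \<gamma> * (norm \<delta>)\<^sup>2)"
      using mult_left_mono[OF 3, of a] a by (simp add: algebra_simps)
    moreover have "(\<beta> * a\<^sup>2 / 2) * (norm \<delta>)\<^sup>2 + (a\<^sup>2 * \<beta> / (2 * (1 - a))) * (norm \<delta>)\<^sup>2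
        \<le> a * q / 2 * (\<beta> * (norm \<delta>)\<^sup>2)"
      using mult_right_mono[OF 6, of "(norm \<delta>)\<^sup>2"] by (simp add: algebra_simps)
    moreover have "a * q / 2 * (\<gamma> * ((norm (x - z))\<^sup>2 - (norm (x' i - z))\<^sup>2) - \<gamma> * (norm \<delta>)\<^sup>2)
        + a * q / 2 * (\<beta> * (norm \<delta>)\<^sup>2)
        + a * q / 2 * potential (next_gamma opt \<eta> \<gamma> x (x' i)) (x' i) \<le> a * q / 2 * potential \<gamma> x"
      using mult_left_mono[OF 5, of "a * q / 2"] a q by (simp add: algebra_simps)
    ultimately show ?thesis
      using 1 2 4 unfolding objective_def xb'_def[symmetric] by linarith
  qed
  \<comment> \<open>Unbiasedness: the snapshot terms cancel in the sum.\<close>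
  have sum_g: "(\<Sum>i=1..n. g i) = real n *\<^sub>R G"
  proof -
    have in_euclid: "xb \<in> euclid d" "u \<in> euclid d" using xb u X_euclid by auto
    show ?thesis
      unfolding g_def G_def sum.distrib sum_subtractf in_euclid[THEN sum_gradients]
      by (simp add: sum_constant_scaleR)
  qed
  have "(\<Sum>i=1..n. (norm (e i))\<^sup>2) \<le> real n * (2 * \<beta> * B)"
    unfolding e_def g_def G_def B_def using xb u X_euclid by (intro variance_bound) auto
  then have "(1 - a) / (2 * \<beta>) * (\<Sum>i=1..n. (norm (e i))\<^sup>2) \<le> (1 - a) / (2 * \<beta>) * (real n * (2 * \<beta> * B))"
    using a \<beta> by (intro mult_left_mono) auto
  also have "\<dots> = real n * ((1 - a) * B)" using \<beta> by simp
  finally have var: "(1 - a) / (2 * \<beta>) * (\<Sum>i=1..n. (norm (e i))\<^sup>2) \<le> real n * ((1 - a) * B)" .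
  have lin: "a * ((\<Sum>i=1..n. g i) \<bullet> (z - x)) = real n * (a * (G \<bullet> (z - x)))"
    unfolding sum_g by simp
  define K where "K = average n f xb + a * h z + (1 - a) * h u - F z + a * q / 2 * potential \<gamma> x"
  have "(\<Sum>i=1..n. gap (a *\<^sub>R x' i + (1 - a) *\<^sub>R u) +
      a * q / 2 * potential (next_gamma opt \<eta> \<gamma> x (x' i)) (x' i)) \<le>
      (\<Sum>i=1..n. K + a * (g i \<bullet> (z - x)) + (1 - a) / (2 * \<beta>) * (norm (e i))\<^sup>2)"
    using single by (intro sum_mono) (simp add: K_def algebra_simps)
  also have "\<dots> = real n * K + a * ((\<Sum>i=1..n. g i) \<bullet> (z - x))
      + (1 - a) / (2 * \<beta>) * (\<Sum>i=1..n. (norm (e i))\<^sup>2)"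
    by (simp add: sum.distrib inner_sum_left sum_distrib_left)
  also have "\<dots> \<le> real n * (K + a * (G \<bullet> (z - x)) + (1 - a) * B)"
    using var unfolding lin distrib_left by linarith
  also have "K + a * (G \<bullet> (z - x)) + (1 - a) * B \<le> (1 - a) * gap u + a * q / 2 * potential \<gamma> x"
  proof -
    \<comment> \<open>Since \<open>xb\<close> averages \<open>x\<close> and \<open>u\<close>, the
      linear term splits into one towards \<open>z\<close>, handled by convexity, and one towards
      \<open>u\<close>, which cancels the inner product in \<open>B\<close>.\<close>
    have "a *\<^sub>R (z - x) = a *\<^sub>R (z - xb) + (1 - a) *\<^sub>R (u - xb)"
      by (simp add: xb_def algebra_simps)
    from arg_cong[OF this, of "inner G"]
    have "a * (G \<bullet> (z - x)) = a * (G \<bullet> (z - xb)) + (1 - a) * (G \<bullet> (u - xb))"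
      by (simp add: inner_add_right)
    moreover have "a * (average n f xb + G \<bullet> (z - xb)) \<le> a * average n f z"
      using average_below_tangents[of xb z] xb z_in X_euclid a
      by (intro mult_left_mono) (auto simp: G_def)
    ultimately show ?thesis by (simp add: K_def B_def objective_def algebra_simps)
  qed
  finally show ?thesis
    using n by (simp add: divide_le_eq mult.commute mult_left_mono)
qed

section \<open>Averages of iterates within an epoch\<close>

lemma convex_on_F: "convex_on X F"
proof -
  have "convex_on X (\<lambda>x. \<Sum>i=1..n. f i x)"
    using problem X_euclid convex_X n
    by (intro convex_on_sum_fun) (auto simp: composite_problem_def intro: convex_on_subset)
  then have "convex_on X (\<lambda>x. inverse (real n) * (\<Sum>i=1..n. f i x))"
    by (intro convex_on_cmul) auto
  then show ?thesis
    using convex_on_add[OF _ convex_h] by (simp add: objective_def[abs_def] average_def divide_inverse mult.commute)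
qed

lemma gap_convex:
  assumes "v \<in> X" "w \<in> X" "0 \<le> t" "t \<le> 1"
  shows "gap ((1 - t) *\<^sub>R v + t *\<^sub>R w) \<le> (1 - t) * gap v + t * gap w"
  using convex_onD[OF convex_on_F assms(3,4,1,2)] by (simp add: algebra_simps)

text \<open>Jensen's inequality for one more point. Multiplying the gap by the number of points
  absorbs the denominators and makes the empty sum at \<open>t = 0\<close> contribute
  nothing.\<close>

lemma gap_running_average:
  assumes y: "t > 0 \<Longrightarrow> y /\<^sub>R real t \<in> X" "t = 0 \<Longrightarrow> y = 0" and w: "w \<in> X"
  shows "(y + w) /\<^sub>R real (Suc t) \<in> X"
    and "real (Suc t) * gap ((y + w) /\<^sub>R real (Suc t)) \<le> real t * gap (y /\<^sub>R real t) + gap w"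
proof -
  have "(y + w) /\<^sub>R real (Suc t) \<in> X \<and>
    real (Suc t) * gap ((y + w) /\<^sub>R real (Suc t)) \<le> real t * gap (y /\<^sub>R real t) + gap w"
  proof (cases "t = 0")
    case True
    then show ?thesis using y w by simp
  next
    case False
    define \<theta> where "\<theta> = 1 / real (Suc t)"
    have \<theta>: "0 \<le> \<theta>" "\<theta> \<le> 1" "real (Suc t) * \<theta> = 1" "real (Suc t) * (1 - \<theta>) = real t"
      by (simp_all add: \<theta>_def field_simps)
    have y': "y /\<^sub>R real t \<in> X" using y False by simp
    have "1 - \<theta> = real t * \<theta>" by (simp add: \<theta>_def field_simps)
    then have "(1 - \<theta>) / real t = \<theta>" using False by simp
    then have eq: "(y + w) /\<^sub>R real (Suc t) = (1 - \<theta>) *\<^sub>R (y /\<^sub>R real t) + \<theta> *\<^sub>R w"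
      by (simp add: \<theta>_def scaleR_add_right divide_inverse)
    have "real (Suc t) * gap ((y + w) /\<^sub>R real (Suc t)) \<le>
        real (Suc t) * ((1 - \<theta>) * gap (y /\<^sub>R real t) + \<theta> * gap w)"
      unfolding eq using \<theta> y' w by (intro mult_left_mono gap_convex) auto
    also have "\<dots> = real t * gap (y /\<^sub>R real t) + gap w"
      by (simp only: distrib_left mult.assoc[symmetric] \<theta>) simp
    finally show ?thesis
      unfolding eq using \<theta> y' w convexD[OF convex_X y' w, of "1 - \<theta>" \<theta>] by auto
  qed
  then show "(y + w) /\<^sub>R real (Suc t) \<in> X"
    "real (Suc t) * gap ((y + w) /\<^sub>R real (Suc t)) \<le> real t * gap (y /\<^sub>R real t) + gap w"
    by auto
qed

text \<open>Isolating the uniform index inside \<open>map_pmf\<close> lets the inner expectation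
  become the average that \<open>step_bound\<close> controls.\<close>

lemma epoch_Suc:
  "epoch n d X f h opt \<eta> a q u x0 \<gamma>0 (Suc t) =
    epoch n d X f h opt \<eta> a q u x0 \<gamma>0 t \<bind> (\<lambda>(x, \<gamma>, y, N).
      map_pmf (\<lambda>i. let x' = step_point a q u x \<gamma> i in
        (x', next_gamma opt \<eta> \<gamma> x x', y + (a *\<^sub>R x' + (1 - a) *\<^sub>R u), N + 2))
      (pmf_of_set {1..n}))"
  by (simp add: map_pmf_def step_point_def Let_def)

lemma epoch_invariant:
  assumes "u \<in> X" "x0 \<in> X" "\<gamma>0 > 0" "0 < a" "a < 1" "q > 0"
    and "(x, \<gamma>, y, N) \<in> set_pmf (epoch n d X f h opt \<eta> a q u x0 \<gamma>0 t)"
  shows "x \<in> X \<and> \<gamma> > 0 \<and> (t > 0 \<longrightarrow> y /\<^sub>R real t \<in> X) \<and> (t = 0 \<longrightarrow> y = 0) \<and> N = n + 2 * t"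
  using assms(7)
proof (induction t arbitrary: x \<gamma> y N)
  case 0
  then show ?case using assms by simp
next
  case (Suc t)
  have "set_pmf (pmf_of_set {1..n}) = {1..n}" using n by (intro set_pmf_of_set) auto
  then obtain x1 \<gamma>1 y1 N1 i where
    prev: "(x1, \<gamma>1, y1, N1) \<in> set_pmf (epoch n d X f h opt \<eta> a q u x0 \<gamma>0 t)"
    and i: "i \<in> {1..n}" and new: "x = step_point a q u x1 \<gamma>1 i" "\<gamma> = next_gamma opt \<eta> \<gamma>1 x1 x"
      "y = y1 + (a *\<^sub>R x + (1 - a) *\<^sub>R u)" "N = N1 + 2"
    using Suc.prems unfolding epoch_Suc by (auto simp: Let_def simp del: epoch.simps)
  note IH = Suc.IH[OF prev]
  have x: "x \<in> X" using IH i assms by (simp add: new step_point_in)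
  moreover have "\<gamma> > 0" using IH next_gamma_ge[of \<gamma>1 opt \<eta> x1 x] by (simp add: new(2))
  moreover have "y /\<^sub>R real (Suc t) \<in> X"
    unfolding new(3) using IH average_point_in[OF x] assms by (intro gap_running_average(1)) auto
  ultimately show ?case using IH new by simp
qed

lemma finite_epoch: "finite (set_pmf (epoch n d X f h opt \<eta> a q u x0 \<gamma>0 t))"
  using n by (induction t) (auto simp: epoch_Suc Let_def set_pmf_of_set simp del: epoch.simps(2))

text \<open>The snapshot is fixed, so \<open>(1 - a) * gap u\<close> is counted once per iteration
  while the potentials telescope.\<close>

lemma epoch_bound:
  assumes u: "u \<in> X" and x0: "x0 \<in> X" and \<gamma>0: "\<gamma>0 > 0" and a: "0 < a" "a < 1" and q: "q > 0"
    and aq: "a * (2 - a) \<le> (1 - a) * q"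
  shows "measure_pmf.expectation (epoch n d X f h opt \<eta> a q u x0 \<gamma>0 t)
      (\<lambda>(x, \<gamma>, y, N). real t * gap (y /\<^sub>R real t) + a * q / 2 * potential \<gamma> x)
    \<le> real t * ((1 - a) * gap u) + a * q / 2 * potential \<gamma>0 x0"
proof (induction t)
  case 0
  show ?case by simp
next
  case (Suc t)
  let ?p = "epoch n d X f h opt \<eta> a q u x0 \<gamma>0 t"
  let ?\<phi> = "\<lambda>t (x, \<gamma>, y, N :: nat). real t * gap (y /\<^sub>R real t) + a * q / 2 * potential \<gamma> x"
  have "measure_pmf.expectation (epoch n d X f h opt \<eta> a q u x0 \<gamma>0 (Suc t)) (?\<phi> (Suc t)) \<le>
      measure_pmf.expectation ?p (\<lambda>s. ?\<phi> t s + (1 - a) * gap u)"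
    unfolding epoch_Suc
  proof (rule expectation_bind_le, goal_cases)
    case 1
    show ?case by (rule finite_epoch)
  next
    case (2 s)
    then show ?case using n by (cases s) (auto simp: set_pmf_of_set)
  next
    case (3 s)
    obtain x \<gamma> y N where s: "s = (x, \<gamma>, y, N)" by (cases s)
    note inv = epoch_invariant[OF u x0 \<gamma>0 a q 3[unfolded s]]
    define x' where "x' = step_point a q u x \<gamma>"
    define w where "w i = a *\<^sub>R x' i + (1 - a) *\<^sub>R u" for i
    have w: "w i \<in> X" if "i \<in> {1..n}" for i
      unfolding w_def x'_def using that inv u a q by (intro average_point_in step_point_in) auto
    have "(\<Sum>i=1..n. real (Suc t) * gap ((y + w i) /\<^sub>R real (Suc t)) +
        a * q / 2 * potential (next_gamma opt \<eta> \<gamma> x (x' i)) (x' i)) / real n \<le>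
      (\<Sum>i=1..n. real t * gap (y /\<^sub>R real t) + (gap (w i) +
        a * q / 2 * potential (next_gamma opt \<eta> \<gamma> x (x' i)) (x' i))) / real n"
      using gap_running_average(2)[of t y] inv w
      by (intro divide_right_mono sum_mono) (auto simp del: of_nat_Suc V_const.simps)
    also have "\<dots> = real t * gap (y /\<^sub>R real t) + (\<Sum>i=1..n. gap (w i) +
        a * q / 2 * potential (next_gamma opt \<eta> \<gamma> x (x' i)) (x' i)) / real n"
      using n by (simp only: sum.distrib[of "\<lambda>_. real t * gap (y /\<^sub>R real t)"]) (simp add: add_divide_distrib)
    also have "\<dots> \<le> real t * gap (y /\<^sub>R real t) + ((1 - a) * gap u + a * q / 2 * potential \<gamma> x)"
      unfolding w_def x'_def using inv u a q aq by (intro add_left_mono step_bound) auto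
    finally show ?case
      using n by (simp add: s integral_pmf_of_set Let_def x'_def w_def algebra_simps del: of_nat_Suc)
  qed
  also have "\<dots> = measure_pmf.expectation ?p (?\<phi> t) + (1 - a) * gap u"
    by (subst Bochner_Integration.integral_add)
       (auto intro: integrable_measure_pmf_finite finite_epoch)
  finally show ?case using Suc.IH by (simp add: algebra_simps)
qed

section \<open>Recursion over epochs\<close>

lemma adavrag_invariant:
  assumes u0: "u0 \<in> X" and \<gamma>0: "\<gamma>0 > 0"
    and a: "\<And>s. s \<ge> 1 \<Longrightarrow> 0 < a s \<and> a s < 1" and q: "\<And>s. s \<ge> 1 \<Longrightarrow> q s > 0"
    and "(u, x, \<gamma>, N) \<in> set_pmf (adavrag n d X f h opt \<eta> a q (\<lambda>_. n) u0 \<gamma>0 s)"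
  shows "u \<in> X \<and> x \<in> X \<and> \<gamma> > 0 \<and> N = s * (3 * n)"
  using assms(5)
proof (induction s arbitrary: u x \<gamma> N)
  case 0
  then show ?case using u0 \<gamma>0 by simp
next
  case (Suc s)
  then obtain u1 x1 \<gamma>1 N1 y M where
    prev: "(u1, x1, \<gamma>1, N1) \<in> set_pmf (adavrag n d X f h opt \<eta> a q (\<lambda>_. n) u0 \<gamma>0 s)"
    and ep: "(x, \<gamma>, y, M) \<in> set_pmf (epoch n d X f h opt \<eta> (a (Suc s)) (q (Suc s)) u1 x1 \<gamma>1 n)"
    and new: "u = y /\<^sub>R real n" "N = N1 + M"
    by auto
  note IH = Suc.IH[OF prev]
  \<comment> \<open>The count is deterministic: \<open>n\<close> evaluations for the snapshot and
    two in each of the \<open>n\<close> iterations.\<close>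
  have "x \<in> X \<and> \<gamma> > 0 \<and> (n > 0 \<longrightarrow> y /\<^sub>R real n \<in> X) \<and> (n = 0 \<longrightarrow> y = 0) \<and> M = n + 2 * n"
    using IH a[of "Suc s"] q[of "Suc s"] by (intro epoch_invariant[OF _ _ _ _ _ _ ep]) auto
  then show ?case using IH new n by simp
qed

lemma finite_adavrag: "finite (set_pmf (adavrag n d X f h opt \<eta> a q T u0 \<gamma>0 s))"
  by (induction s) (auto intro!: finite_UN_I finite_epoch split: prod.split)

text \<open>Scaling an epoch by \<open>2 / (a * q)\<close> gives the potential coefficient 1 in
  every epoch, so the potentials telescope across epochs and the gap carries
  \<open>w (Suc s)\<close>. As the old gap is nonnegative, \<open>w_le\<close> bounds its remaining
  share by the previous weight.\<close>

lemma adavrag_bound: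
  assumes u0: "u0 \<in> X" and \<gamma>0: "\<gamma>0 > 0"
    and a: "\<And>s. s \<ge> 1 \<Longrightarrow> 0 < a s \<and> a s < 1" and q: "\<And>s. s \<ge> 1 \<Longrightarrow> q s > 0"
    and aq: "\<And>s. s \<ge> 1 \<Longrightarrow> a s * (2 - a s) \<le> (1 - a s) * q s"
    and w: "\<And>s. w (Suc s) * (a (Suc s) * q (Suc s)) = 2 * real n"
    and w_le: "\<And>s. w (Suc s) * (1 - a (Suc s)) \<le> w s"
  shows "measure_pmf.expectation (adavrag n d X f h opt \<eta> a q (\<lambda>_. n) u0 \<gamma>0 s)
      (\<lambda>(u, x, \<gamma>, N). w s * gap u + potential \<gamma> x) \<le> w 0 * gap u0 + potential \<gamma>0 u0"
proof (induction s)
  case 0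
  show ?case by simp
next
  case (Suc s)
  define a' q' where "a' = a (Suc s)" and "q' = q (Suc s)"
  have a': "0 < a'" "a' < 1" and q': "q' > 0" and aq': "a' * (2 - a') \<le> (1 - a') * q'"
    using a[of "Suc s"] q[of "Suc s"] aq[of "Suc s"] by (simp_all add: a'_def q'_def)
  define m where "m = 2 / (a' * q')"
  have m: "m > 0" "m * (a' * q' / 2) = 1" using a' q' by (simp_all add: m_def)
  have w': "w (Suc s) = m * real n"
    using w[of s] a' q' by (simp add: m_def a'_def q'_def field_simps)
  let ?p = "adavrag n d X f h opt \<eta> a q (\<lambda>_. n) u0 \<gamma>0 s"
  let ?\<phi> = "\<lambda>s (u, x, \<gamma>, N :: nat). w s * gap u + potential \<gamma> x"
  have "measure_pmf.expectation (adavrag n d X f h opt \<eta> a q (\<lambda>_. n) u0 \<gamma>0 (Suc s)) (?\<phi> (Suc s))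
      \<le> measure_pmf.expectation ?p (?\<phi> s)"
    unfolding adavrag.simps
  proof (rule expectation_bind_le, goal_cases)
    case 1
    show ?case by (rule finite_adavrag)
  next
    case (2 st)
    then show ?case by (cases st) (auto intro: finite_epoch)
  next
    case (3 st)
    obtain u x \<gamma> N where st: "st = (u, x, \<gamma>, N)" by (cases st)
    note inv = adavrag_invariant[OF u0 \<gamma>0 a q 3[unfolded st], simplified]
    let ?e = "epoch n d X f h opt \<eta> a' q' u x \<gamma> n"
    let ?\<psi> = "\<lambda>(x, \<gamma>, y, N :: nat). real n * gap (y /\<^sub>R real n) + a' * q' / 2 * potential \<gamma> x"
    have "measure_pmf.expectation (?e \<bind> (\<lambda>(x', \<gamma>', y, M). return_pmf (y /\<^sub>R real n, x', \<gamma>', N + M)))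
          (?\<phi> (Suc s)) \<le> measure_pmf.expectation ?e (\<lambda>st. m * ?\<psi> st)"
    proof (rule expectation_bind_le, goal_cases)
      case (3 st')
      then show ?case
      proof (cases st')
        case (fields x' \<gamma>' y M)
        have eq: "m * (a' * (q' * v)) = 2 * v" for v
          using m(2) by (simp add: mult.assoc[symmetric])
        show ?thesis
          unfolding fields by (simp add: w' eq distrib_left mult.assoc del: V_const.simps)
      qed
    qed (auto intro: finite_epoch split: prod.split)
    also have "\<dots> = m * measure_pmf.expectation ?e ?\<psi>" by simp
    also have "\<dots> \<le> m * (real n * ((1 - a') * gap u) + a' * q' / 2 * potential \<gamma> x)"
      using m(1) inv a' q' aq' by (intro mult_left_mono epoch_bound) auto
    also have "\<dots> = (w (Suc s) * (1 - a')) * gap u + potential \<gamma> x"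
      unfolding w' distrib_left mult.assoc[symmetric] m(2)[unfolded mult.assoc[symmetric]]
      using m(2) by simp
    also have "\<dots> \<le> w s * gap u + potential \<gamma> x"
      using w_le[of s] inv gap_nonneg[of u] by (intro add_right_mono mult_right_mono) (auto simp: a'_def)
    finally show ?case by (simp add: st a'_def q'_def)
  qed
  then show ?case using Suc.IH by linarith
qed

text \<open>The starting weight \<open>1 / 2\<close> matches the summand \<open>\<Delta> / 2\<close>
  of \<open>V_const\<close>; the final potential is dropped as nonnegative.\<close>

lemma adavrag_gap_bound:
  assumes "u0 \<in> X" and \<gamma>0: "\<gamma>0 > 0"
    and a: "\<And>s. s \<ge> 1 \<Longrightarrow> 0 < a s \<and> a s < 1" and q: "\<And>s. s \<ge> 1 \<Longrightarrow> q s > 0"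
    and "\<And>s. s \<ge> 1 \<Longrightarrow> a s * (2 - a s) \<le> (1 - a s) * q s"
    and "\<And>s. w (Suc s) * (a (Suc s) * q (Suc s)) = 2 * real n"
    and "\<And>s. w (Suc s) * (1 - a (Suc s)) \<le> w s"
    and w0: "w 0 = 1 / 2"
  shows "w s * measure_pmf.expectation (adavrag n d X f h opt \<eta> a q (\<lambda>_. n) u0 \<gamma>0 s)
      (\<lambda>(u, x, \<gamma>, N). gap u) \<le> V_const opt \<beta> \<gamma>0 \<eta> D (gap u0) (norm (u0 - z))"
proof -
  let ?p = "adavrag n d X f h opt \<eta> a q (\<lambda>_. n) u0 \<gamma>0 s"
  have "w s * measure_pmf.expectation ?p (\<lambda>(u, x, \<gamma>, N). gap u)
      = measure_pmf.expectation ?p (\<lambda>st. w s * (case st of (u, x, \<gamma>, N) \<Rightarrow> gap u))"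
    by (simp only: integral_mult_right_zero)
  also have "\<dots> \<le> measure_pmf.expectation ?p (\<lambda>(u, x, \<gamma>, N). w s * gap u + potential \<gamma> x)"
  proof (intro integral_mono_AE integrable_measure_pmf_finite finite_adavrag AE_pmfI)
    fix st assume st: "st \<in> set_pmf ?p"
    obtain u x \<gamma> N where eq: "st = (u, x, \<gamma>, N)" by (cases st)
    have "\<gamma> > 0" using adavrag_invariant[OF assms(1-4) st[unfolded eq]] by simp
    then show "w s * (case st of (u, x, \<gamma>, N) \<Rightarrow> gap u)
        \<le> (case st of (u, x, \<gamma>, N) \<Rightarrow> w s * gap u + potential \<gamma> x)"
      unfolding eq using V_const_nonneg \<eta> by simp
  qed
  also have "\<dots> \<le> w 0 * gap u0 + potential \<gamma>0 u0"
    by (intro adavrag_bound assms)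
  also have "\<dots> = V_const opt \<beta> \<gamma>0 \<eta> D (gap u0) (norm (u0 - z))"
    unfolding w0 by (subst V_const_split[of _ _ _ _ _ "gap u0"]) simp
  finally show ?thesis .
qed

end

section \<open>The parameter schedule\<close>

text \<open>This is \<open>2 * n / (a * q)\<close> written out for the two phases. The first branch
  also covers \<open>s = 0\<close>, where it gives the starting weight \<open>1 / 2\<close>.\<close>

definition weight :: "nat \<Rightarrow> nat \<Rightarrow> real" where
  "weight n s = (if s \<le> s0 n then 2 * real n * (4 * real n) powr (- ((1/2) ^ s))
     else 3 * real n / 4 * ((real s - real (s0 n) + c0) * (real s - real (s0 n) + 2 * c0)\<^sup>2 /
       ((2 * (real s - real (s0 n)) + 3 * c0) * c0\<^sup>2)))"

lemma c0_bounds: "2 < c0" "c0 \<le> 9 / 4"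
proof -
  have "5 < sqrt 33" "sqrt 33 \<le> 6" by (auto intro: real_less_rsqrt real_le_lsqrt)
  then show "2 < c0" "c0 \<le> 9 / 4" by (auto simp: c0_def)
qed

lemma c0_root: "2 * c0\<^sup>2 = 3 * c0 + 3"
  by (simp add: c0_def power2_eq_square field_simps)

text \<open>Rounding the iterated logarithm up makes the exponent at \<open>s0 n\<close> so small
  that \<open>4 * n\<close> raised to it is at most 2; the last claim is the reciprocal.\<close>

lemma s0_bounds:
  assumes n: "n \<ge> 1"
  shows "1 \<le> s0 n" "real (s0 n) < log 2 (log 2 (4 * real n)) + 1"
    "1 / 2 \<le> (4 * real n) powr (- ((1/2) ^ s0 n))"
proof -
  define L where "L = log 2 (4 * real n)"
  have "log 2 4 \<le> L" unfolding L_def using n by (subst log_le_cancel_iff) auto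
  moreover have "log 2 4 = (2 :: real)" using log_pow_cancel[of 2 2] by simp
  ultimately have L: "L \<ge> 2" by simp
  then have "log 2 L \<ge> log 2 2" by (subst log_le_cancel_iff) auto
  then have LL: "log 2 L \<ge> 1" by simp
  show "1 \<le> s0 n" "real (s0 n) < log 2 (log 2 (4 * real n)) + 1"
    using LL unfolding s0_def L_def[symmetric] by linarith+
  have "log 2 L \<le> real (s0 n)" using LL unfolding s0_def L_def[symmetric] by linarith
  then have "L \<le> 2 powr real (s0 n)" using L by (simp add: log_le_iff)
  then have "L \<le> 2 ^ s0 n" by (simp add: powr_realpow)
  then have "L * (1/2) ^ s0 n \<le> 1" by (simp add: power_one_over field_simps)
  have "4 * real n = 2 powr L" unfolding L_def using n by simp
  then have "(4 * real n) powr (- ((1/2) ^ s0 n)) = 2 powr (- (L * (1/2) ^ s0 n))"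
    by (simp add: powr_powr)
  also have "\<dots> \<ge> 2 powr (- 1)" using \<open>L * (1/2) ^ s0 n \<le> 1\<close> by (intro powr_mono) auto
  finally show "1 / 2 \<le> (4 * real n) powr (- ((1/2) ^ s0 n))" by (simp add: powr_minus)
qed

lemma a_sched_bounds:
  assumes n: "n \<ge> 1" and s: "s \<ge> 1"
  shows "0 < a_sched n s" "a_sched n s < 1"
proof -
  have "0 < a_sched n s \<and> a_sched n s < 1"
  proof (cases "s \<le> s0 n")
    case True
    have "(4 * real n) powr (- ((1/2) ^ s)) < (4 * real n) powr 0"
      using n by (intro powr_less_mono) auto
    then show ?thesis using True n by (simp add: a_sched_def)
  next
    case False
    then show ?thesis using c0_bounds by (simp add: a_sched_def)
  qed
  then show "0 < a_sched n s" "a_sched n s < 1" by auto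
qed

lemma q_sched_pos:
  assumes "n \<ge> 1" "s \<ge> 1"
  shows "0 < q_sched n s"
  using a_sched_bounds[OF assms] by (simp add: q_sched_def)

text \<open>In the first phase \<open>(1 - a) * q = 1 / a\<close>, and
  \<open>a * a * (2 - a) \<le> 1\<close>. In the second the two sides differ by the factor
  \<open>8 / 3\<close>.\<close>

lemma a_q_sched:
  assumes "n \<ge> 1" "s \<ge> 1"
  shows "a_sched n s * (2 - a_sched n s) \<le> (1 - a_sched n s) * q_sched n s"
proof -
  define a where "a = a_sched n s"
  have a: "0 < a" "a < 1" using a_sched_bounds[OF assms] by (simp_all add: a_def)
  show ?thesis
  proof (cases "s \<le> s0 n")
    case True
    have "a * (a * (2 - a)) \<le> a * (2 - a)" using a by (intro mult_left_le_one_le) auto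
    also have "a * (2 - a) = 1 - (1 - a)\<^sup>2" by (simp add: power2_eq_square algebra_simps)
    also have "\<dots> \<le> 1" by simp
    finally have "a * (2 - a) \<le> 1 / a" using a by (simp add: field_simps)
    then show ?thesis using True a by (simp add: q_sched_def a_def[symmetric])
  next
    case False
    have "q_sched n s = 8 / 3 * (a * (2 - a)) / (1 - a)"
      using False by (simp add: q_sched_def a_def[symmetric] mult_ac)
    moreover have "b * (p / b) = p" if "b \<noteq> 0" for b p :: real using that by simp
    ultimately have "(1 - a) * q_sched n s = 8 / 3 * (a * (2 - a))" using a(2) by (metis diff_gt_0_iff_gt less_irrefl)
    moreover have "a * (2 - a) \<ge> 0" using a by simp
    ultimately show ?thesis unfolding a_def by linarith
  qed
qed

lemma weight_0: "n \<ge> 1 \<Longrightarrow> weight n 0 = 1 / 2"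
  by (simp add: weight_def powr_minus)

lemma weight_eq:
  assumes n: "n \<ge> 1" and s: "s \<ge> 1"
  shows "weight n s * (a_sched n s * q_sched n s) = 2 * real n"
proof (cases "s \<le> s0 n")
  case True
  define b where "b = (4 * real n) powr (- ((1/2) ^ s))"
  have "a_sched n s = 1 - b" "weight n s = 2 * real n * b"
    using True by (simp_all add: a_sched_def weight_def b_def)
  then show ?thesis
    using a_sched_bounds[OF n s] True by (simp add: q_sched_def)
next
  case False
  define k where "k = real s - real (s0 n)"
  have k: "k > 0" using False by (simp add: k_def)
  define a where "a = a_sched n s"
  have a: "a = c0 / (k + 2 * c0)" using False by (simp add: a_def a_sched_def k_def)
  have a1: "1 - a = (k + c0) / (k + 2 * c0)" "2 - a = (2 * k + 3 * c0) / (k + 2 * c0)"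
    using k c0_bounds by (simp_all add: a field_simps)
  have q: "q_sched n s = 8 * (2 - a) * a / (3 * (1 - a))"
    using False by (simp add: q_sched_def a_def)
  have "a * q_sched n s = 8 * (2 * k + 3 * c0) * c0\<^sup>2 / (3 * (k + c0) * (k + 2 * c0)\<^sup>2)"
    unfolding q a1 unfolding a using k c0_bounds by (simp add: power2_eq_square mult_ac)
  then have aq: "a_sched n s * q_sched n s =
      8 * (2 * k + 3 * c0) * c0\<^sup>2 / (3 * (k + c0) * (k + 2 * c0)\<^sup>2)"
    by (simp only: a_def)
  have w: "weight n s = 3 * real n / 4 *
      ((k + c0) * (k + 2 * c0)\<^sup>2 / ((2 * k + 3 * c0) * c0\<^sup>2))"
    using False by (simp add: weight_def k_def)
  have cancel: "3 * N / 4 * (A * B\<^sup>2 / (E * c\<^sup>2)) * (8 * E * c\<^sup>2 / (3 * A * B\<^sup>2)) = 2 * N"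
    if "A \<noteq> 0" "B \<noteq> 0" "E \<noteq> 0" "c \<noteq> 0" for N A B E c :: real
    using that by simp
  show ?thesis
    unfolding aq w by (rule cancel) (use k c0_bounds in auto)
qed

text \<open>Joins the phases: at \<open>s = s0 n\<close> the second-phase formula gives exactly
  \<open>n\<close>, and the first-phase weight is at least that. The first epoch of the second phase
  is compared with this value.\<close>

lemma weight_ge_formula:
  assumes n: "n \<ge> 1" and s: "s \<ge> s0 n"
  shows "3 * real n / 4 * ((real s - real (s0 n) + c0) * (real s - real (s0 n) + 2 * c0)\<^sup>2 /
       ((2 * (real s - real (s0 n)) + 3 * c0) * c0\<^sup>2)) \<le> weight n s"
proof (cases "s = s0 n")
  case True
  have "c0 \<noteq> 0" using c0_bounds by auto
  have "real n * 1 \<le> real n * (2 * (4 * real n) powr (- ((1/2) ^ s0 n)))"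
    using s0_bounds(3)[OF n] by (intro mult_left_mono) auto
  then show ?thesis using True \<open>c0 \<noteq> 0\<close> by (simp add: weight_def power2_eq_square)
next
  case False
  then show ?thesis using s by (simp add: weight_def)
qed

text \<open>The constant \<open>c0\<close> is the root that makes the inequality below an equality at \<open>k = 0\<close>.\<close>

lemma phase2_inequality:
  fixes k :: real
  assumes k: "k \<ge> 0"
  shows "(k + 1 + c0)\<^sup>2 * (k + 1 + 2 * c0) / (2 * k + 2 + 3 * c0) \<le>
    (k + c0) * (k + 2 * c0)\<^sup>2 / (2 * k + 3 * c0)"
proof -
  \<comment> \<open>The cross-multiplied difference, reduced modulo the equation of
    \<open>c0\<close>: \<open>c0_root\<close> removes the last product, and
    \<open>2 < c0 \<le> 9 / 4\<close> makes the remaining coefficients nonnegative.\<close>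
  have "(k + c0) * (k + 2 * c0)\<^sup>2 * (2 * k + 2 + 3 * c0)
      - (k + 1 + c0)\<^sup>2 * (k + 1 + 2 * c0) * (2 * k + 3 * c0)
      = k * ((1 + 19 * c0) / 4 + (15 - 3 * c0) / 2 * k + (2 * c0 - 4) * k\<^sup>2)
        + (2 * c0\<^sup>2 - (3 * c0 + 3)) * (3 * c0\<^sup>2 + 13 / 2 * k * c0 + c0 + 9 / 2 * k\<^sup>2 + 3 / 4 * k)"
    by (simp add: power2_eq_square algebra_simps add_divide_distrib diff_divide_distrib)
  also have "\<dots> = k * ((1 + 19 * c0) / 4 + (15 - 3 * c0) / 2 * k + (2 * c0 - 4) * k\<^sup>2)"
    by (simp add: c0_root)
  also have "\<dots> \<ge> 0"
    using k c0_bounds by (intro mult_nonneg_nonneg add_nonneg_nonneg) auto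
  finally show ?thesis
    using k c0_bounds by (simp add: divide_le_eq le_divide_eq mult.commute mult.left_commute mult.assoc)
qed

lemma weight_decrease:
  assumes n: "n \<ge> 1"
  shows "weight n (Suc s) * (1 - a_sched n (Suc s)) \<le> weight n s"
proof (cases "Suc s \<le> s0 n")
  case True
  \<comment> \<open>The exponent halves from one epoch to the next, so the square of the new power
    is the old one and the first phase satisfies the claim with equality.\<close>
  have "(4 * real n) powr (- ((1/2) ^ Suc s)) * (4 * real n) powr (- ((1/2) ^ Suc s))
      = (4 * real n) powr (- ((1/2) ^ s))"
    by (simp flip: powr_add)
  then show ?thesis using True by (simp add: weight_def a_sched_def)
next
  case False
  define k where "k = real s - real (s0 n)"
  have k: "k \<ge> 0" using False by (simp add: k_def)
  have Suc_k: "real (Suc s) - real (s0 n) = k + 1" by (simp add: k_def)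
  have "a_sched n (Suc s) = c0 / (k + 1 + 2 * c0)"
    using False unfolding a_sched_def Suc_k by (simp only: if_False)
  then have a: "1 - a_sched n (Suc s) = (k + 1 + c0) / (k + 1 + 2 * c0)"
    using k c0_bounds by (simp add: field_simps)
  have "2 * (k + 1) + 3 * c0 = 2 * k + 2 + 3 * c0" by simp
  then have w: "weight n (Suc s) = 3 * real n / 4 *
      ((k + 1 + c0) * (k + 1 + 2 * c0)\<^sup>2 / ((2 * k + 2 + 3 * c0) * c0\<^sup>2))"
    unfolding weight_def Suc_k using False by (simp only: if_False)
  have cancel: "3 * N / 4 * (A * B\<^sup>2 / (E * c\<^sup>2)) * (A / B) = 3 * N / (4 * c\<^sup>2) * (A\<^sup>2 * B / E)"
    if "B \<noteq> 0" for N A B E c :: real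
    using that by (simp add: power2_eq_square mult_ac)
  have "weight n (Suc s) * (1 - a_sched n (Suc s)) = 3 * real n / (4 * c0\<^sup>2) *
      ((k + 1 + c0)\<^sup>2 * (k + 1 + 2 * c0) / (2 * k + 2 + 3 * c0))"
    unfolding a w by (rule cancel) (use k c0_bounds in auto)
  also have "\<dots> \<le> 3 * real n / (4 * c0\<^sup>2) * ((k + c0) * (k + 2 * c0)\<^sup>2 / (2 * k + 3 * c0))"
    using phase2_inequality[OF k] by (intro mult_left_mono) auto
  also have "\<dots> = 3 * real n / 4 * ((k + c0) * (k + 2 * c0)\<^sup>2 / ((2 * k + 3 * c0) * c0\<^sup>2))"
    by (simp only: times_divide_times_eq mult_ac)
  also have "\<dots> \<le> weight n s"
    unfolding k_def by (rule weight_ge_formula[OF n]) (use False in simp)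
  finally show ?thesis .
qed

section \<open>Growth of the weights\<close>

lemma weight_phase1:
  assumes n: "n \<ge> 1"
  shows "sqrt (real n) \<le> weight n 1" "real n \<le> weight n (s0 n)"
proof -
  have "(4 * real n) powr (1/2) = 2 * sqrt (real n)"
    by (simp add: powr_half_sqrt real_sqrt_mult)
  then have "(4 * real n) powr (- (1/2)) = 1 / (2 * sqrt (real n))"
    by (simp only: powr_minus inverse_eq_divide)
  then have "weight n 1 = 2 * real n * (1 / (2 * sqrt (real n)))"
    using s0_bounds(1)[OF n] by (simp only: weight_def power_one_right if_True)
  also have "\<dots> = sqrt (real n)" by (simp add: real_div_sqrt)
  finally have "weight n 1 = sqrt (real n)" .
  then show "sqrt (real n) \<le> weight n 1" by simp
  show "real n \<le> weight n (s0 n)"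
    using s0_bounds(3)[OF n] n by (simp add: weight_def)
qed

text \<open>The quotient of the linear factors is at least \<open>1 / 3\<close>,
  \<open>(k + 2 * c0)^2 \<ge> k^2\<close>, and \<open>c0^2 \<le> 21 / 4\<close>; hence the constant
  21.\<close>

lemma weight_phase2:
  assumes n: "n \<ge> 1" and k: "k \<ge> 1"
  shows "real n * (real k)\<^sup>2 / 21 \<le> weight n (s0 n + k)"
proof -
  have c: "c0 > 0" "c0\<^sup>2 \<le> 21 / 4"
    using c0_bounds power_mono[of c0 "9/4" 2] by (auto simp: power2_eq_square)
  have "(real k)\<^sup>2 * ((2 * real k + 3 * c0) * (4 * c0\<^sup>2)) \<le>
      (real k)\<^sup>2 * ((2 * real k + 3 * c0) * 21)"
    using c by (intro mult_left_mono) auto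
  also have "\<dots> \<le> (real k + 2 * c0)\<^sup>2 * (63 * (real k + c0))"
  proof -
    have "(2 * real k + 3 * c0) * 21 \<le> 63 * (real k + c0)" by simp
    then show ?thesis using c by (intro mult_mono[OF power_mono]) auto
  qed
  also have "\<dots> = ((real k + c0) * (real k + 2 * c0)\<^sup>2) * 63" by (simp only: mult_ac)
  finally have "(real k)\<^sup>2 * (((2 * real k + 3 * c0) * c0\<^sup>2) * 4) \<le>
      ((real k + c0) * (real k + 2 * c0)\<^sup>2) * 63"
    by (simp only: mult_ac)
  moreover have "x / 21 \<le> 3 / 4 * (p / q)" if "x * (q * 4) \<le> p * 63" "q > 0" for x p q :: real
    using that by (simp add: field_simps)
  moreover have "0 < (2 * real k + 3 * c0) * c0\<^sup>2" using c by simp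
  ultimately have "(real k)\<^sup>2 / 21 \<le>
      3 / 4 * ((real k + c0) * (real k + 2 * c0)\<^sup>2 / ((2 * real k + 3 * c0) * c0\<^sup>2))"
    by blast
  then have "real n * ((real k)\<^sup>2 / 21) \<le> real n *
      (3 / 4 * ((real k + c0) * (real k + 2 * c0)\<^sup>2 / ((2 * real k + 3 * c0) * c0\<^sup>2)))"
    by (intro mult_left_mono) auto
  then show ?thesis using k by (simp add: weight_def)
qed

section \<open>The number of epochs\<close>

lemma loglog_ge_1: "1 \<le> loglog x"
  by (simp add: loglog_def)

text \<open>Under two logarithms a square root costs only an additive constant, so \<open>m\<close>
  may be as small as \<open>sqrt n\<close>. The general \<open>m\<close> serves for both
  \<open>V / \<epsilon>\<close> and \<open>n\<close>.\<close>

lemma s0_le_loglog: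
  assumes n: "n \<ge> 1" and m: "sqrt (real n) \<le> m" "m > 1"
  shows "real (s0 n) \<le> 9 * loglog m"
proof -
  define y where "y = ln m"
  have y: "y > 0" using m by (simp add: y_def)
  have ln2: "2 / 3 \<le> ln (2 :: real)" by (rule ln2_ge_two_thirds)
  have div_ln2: "x / ln 2 \<le> 3 / 2 * x" if "x \<ge> 0" for x :: real
  proof -
    have "2 / 3 * x \<le> ln 2 * x" using ln2 that by (rule mult_right_mono)
    then show ?thesis using ln2 by (simp add: divide_le_eq mult_ac)
  qed
  have "ln (real n) = 2 * ln (sqrt (real n))" using n by (simp add: ln_sqrt)
  also have "\<dots> \<le> 2 * y" using n m by (simp add: y_def)
  finally have "ln (real n) / ln 2 \<le> (2 * y) / ln 2" by (intro divide_right_mono) auto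
  also have "\<dots> \<le> 3 * y" using div_ln2[of "2 * y"] y by simp
  finally have "log 2 (real n) \<le> 3 * y" by (simp add: log_def)
  moreover have "log 2 (4 * real n) = 2 + log 2 (real n)"
    using n log_pow_cancel[of 2 2] by (simp add: log_mult)
  moreover have "log 2 (real n) \<ge> 0" using n by simp
  ultimately have L: "2 \<le> log 2 (4 * real n)" "log 2 (4 * real n) \<le> 2 + 3 * y" by simp_all
  have "ln (log 2 (4 * real n)) \<le> ln (2 + 3 * y)" using L by simp
  \<comment> \<open>\<open>max 1 y\<close> handles small \<open>y\<close>, and the additive 4 is
    absorbed below because \<open>loglog\<close> is at least 1.\<close>
  also have "\<dots> \<le> 4 + ln (max 1 y)"
  proof -
    have "ln (2 + 3 * y) \<le> ln (5 * max 1 y)" using y by (subst ln_le_cancel_iff) auto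
    also have "\<dots> = ln 5 + ln (max 1 y)" by (simp add: ln_mult)
    also have "ln 5 \<le> (4 :: real)" using ln_le_minus_one[of 5] by simp
    finally show ?thesis by simp
  qed
  also have "ln (max 1 y) \<le> loglog m"
    using m y ln_le_minus_one[OF y] by (auto simp: loglog_def y_def[symmetric] max_def)
  finally have "ln (log 2 (4 * real n)) \<le> 5 * loglog m" using loglog_ge_1[of m] by linarith
  moreover have "0 \<le> ln (log 2 (4 * real n))" using L by simp
  ultimately have "log 2 (log 2 (4 * real n)) \<le> 15 / 2 * loglog m"
    using div_ln2[of "ln (log 2 (4 * real n))"] by (simp add: log_def)
  \<comment> \<open>Rounding up in \<open>s0\<close> adds at most 1, so the factor
    \<open>15 / 2\<close> stays below 9.\<close>
  then show ?thesis
    using s0_bounds(2)[OF n] loglog_ge_1[of m] by linarith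
qed

lemma s0_le_loglog_self:
  assumes n: "n \<ge> 1"
  shows "real (s0 n) \<le> 9 * loglog (real n)"
proof (cases "n = 1")
  case True
  have "log 2 4 = (2 :: real)" using log_pow_cancel[of 2 2] by simp
  then have "s0 n = 1" using True by (simp add: s0_def)
  then show ?thesis using loglog_ge_1[of "real n"] by simp
next
  case False
  then have "real n > 1" using n by simp
  moreover have "sqrt (real n) \<le> real n" using n by (intro real_le_lsqrt) (auto simp: power2_eq_square)
  ultimately show ?thesis by (intro s0_le_loglog n)
qed

text \<open>Down to accuracy \<open>V / sqrt n\<close> one epoch suffices; beyond that \<open>log log (V / \<epsilon>)\<close> is
  comparable with \<open>log log n\<close>, so that the whole first phase can be afforded.\<close>

lemma epoch_count_exists:
  assumes n: "n \<ge> 1" and V: "V \<ge> 0" and \<epsilon>: "\<epsilon> > 0"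
  shows "\<exists>S\<ge>1. 0 < weight n S \<and> V \<le> weight n S * \<epsilon> \<and>
    real (S * (3 * n)) \<le> 27 * (if \<epsilon> \<ge> V / real n then real n * loglog (V / \<epsilon>)
      else real n * loglog (real n) + sqrt (real n * V / \<epsilon>))"
proof -
  \<comment> \<open>\<open>r\<close> is the weight to be reached: one epoch reaches
    \<open>sqrt n\<close>, the first phase reaches \<open>n\<close>, and beyond that
    \<open>K\<close> further epochs of order \<open>sqrt (r / n)\<close> suffice.\<close>
  define r where "r = V / \<epsilon>"
  have r: "r \<ge> 0" "V = r * \<epsilon>" using V \<epsilon> by (simp_all add: r_def)
  have suff: "V \<le> weight n S * \<epsilon>" if "r \<le> weight n S" for S
    using that \<epsilon> by (simp add: r(2))
  have n0: "real n > 0" using n by simp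
  show ?thesis
  proof (cases "\<epsilon> \<ge> V / real n")
    case True
    then have rn: "r \<le> real n" using n \<epsilon> by (simp add: r_def field_simps)
    show ?thesis
    proof (cases "r \<le> sqrt (real n)")
      case r_le: True
      have "0 < sqrt (real n)" using n by simp
      then have "0 < weight n 1" using weight_phase1(1)[OF n] by linarith
      moreover have "real (1 * (3 * n)) \<le> 27 * (real n * loglog (V / \<epsilon>))"
        using mult_left_mono[OF loglog_ge_1[of "V / \<epsilon>"], of "real n"] n by simp
      ultimately show ?thesis
        using weight_phase1(1)[OF n] r_le True suff[of 1]
        by (intro exI[of _ 1]) auto
    next
      case r_gt: False
      have "1 \<le> sqrt (real n)" using n by simp
      then have "1 < r" using r_gt by linarith
      then have "real (s0 n) \<le> 9 * loglog (V / \<epsilon>)"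
        unfolding r_def[symmetric] using r_gt by (intro s0_le_loglog n) auto
      then have "real n * real (s0 n) \<le> real n * (9 * loglog (V / \<epsilon>))"
        using n by (intro mult_left_mono) auto
      then have "real (s0 n * (3 * n)) \<le> 27 * (real n * loglog (V / \<epsilon>))" by (simp add: mult_ac)
      then show ?thesis
        using weight_phase1(2)[OF n] rn True suff[of "s0 n"] s0_bounds(1)[OF n] n0
        by (intro exI[of _ "s0 n"]) auto
    qed
  next
    case False
    then have rn: "r > real n" using n \<epsilon> by (simp add: r_def field_simps)
    define \<sigma> where "\<sigma> = sqrt (r / real n)"
    have \<sigma>: "1 \<le> \<sigma>" "\<sigma>\<^sup>2 = r / real n" using rn n r by (simp_all add: \<sigma>_def)
    \<comment> \<open>The factor 5 is enough because \<open>25 \<ge> 21\<close>, the constant of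
      \<open>weight_phase2\<close>; rounding up costs at most \<open>\<sigma>\<close>, as
      \<open>\<sigma> \<ge> 1\<close>.\<close>
    define K where "K = nat \<lceil>5 * \<sigma>\<rceil>"
    have K: "5 * \<sigma> \<le> real K" "real K \<le> 6 * \<sigma>" "K \<ge> 1"
      using \<sigma>(1) unfolding K_def by linarith+
    have "25 * \<sigma>\<^sup>2 \<le> (real K)\<^sup>2"
      using power_mono[OF K(1), of 2] \<sigma>(1) by (simp add: power_mult_distrib)
    then have "25 * r \<le> real n * (real K)\<^sup>2" using n0 by (simp add: \<sigma>(2) field_simps)
    then have r_le: "r \<le> weight n (s0 n + K)" using weight_phase2[OF n K(3)] r by linarith
    have n\<sigma>: "real n * \<sigma> = sqrt (real n * V / \<epsilon>)"
    proof -
      have "real n * \<sigma> = sqrt ((real n)\<^sup>2 * (r / real n))" unfolding \<sigma>_def real_sqrt_mult by simp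
      then show ?thesis using n0 by (simp add: r_def power2_eq_square)
    qed
    have "real n * real K \<le> 6 * (real n * \<sigma>)"
      using mult_left_mono[OF K(2), of "real n"] by (simp add: mult.left_commute)
    moreover have "real n * real (s0 n) \<le> 9 * (real n * loglog (real n))"
      using mult_left_mono[OF s0_le_loglog_self[OF n], of "real n"] by (simp add: mult.left_commute)
    moreover have "0 \<le> real n * \<sigma>" using \<sigma> by simp
    ultimately have "3 * (real n * real (s0 n) + real n * real K)
        \<le> 27 * (real n * loglog (real n) + sqrt (real n * V / \<epsilon>))"
      unfolding n\<sigma>[symmetric] distrib_left by linarith
    then have "real ((s0 n + K) * (3 * n)) \<le> 27 * (real n * loglog (real n) + sqrt (real n * V / \<epsilon>))"
      by (simp add: algebra_simps)
    moreover have "0 < weight n (s0 n + K)" using r_le rn n0 by linarith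
    ultimately show ?thesis
      using False suff[OF r_le] K(3) by (intro exI[of _ "s0 n + K"]) auto
  qed
qed

theorem theoremB1:
  shows "\<exists>C>0. \<forall>(n::nat) (d::nat) X f h \<beta> xstar u0 \<gamma> D \<kappa> \<eta> opt V.
    composite_problem n d X f h \<beta> \<and>
    is_arg_min (objective n f h) (\<lambda>x. x \<in> X) xstar \<and>
    u0 \<in> X \<and> \<gamma> > 0 \<and>
    compact X \<and> D > 0 \<and> diameter X \<le> D \<and>
    \<kappa> > 0 \<and> \<eta> = \<kappa> * D \<and>
    (opt = Option_I \<longrightarrow> 2 * \<eta>\<^sup>2 > D\<^sup>2) \<and>
    V = V_const opt \<beta> \<gamma> \<eta> D (objective n f h u0 - objective n f h xstar) (norm (u0 - xstar))
    \<longrightarrow> (\<forall>\<epsilon>>0. \<exists>S\<ge>1.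
      let run = adavrag n d X f h opt \<eta> (a_sched n) (q_sched n) (\<lambda>_. n) u0 \<gamma> S in
        measure_pmf.expectation run (\<lambda>(u, x, \<gamma>', N). objective n f h u - objective n f h xstar) \<le> \<epsilon> \<and>
        (\<forall>(u, x, \<gamma>', N)\<in>set_pmf run.
           real N \<le> C * (if \<epsilon> \<ge> V / real n
                          then real n * loglog (V / \<epsilon>)
                          else real n * loglog (real n) + sqrt (real n * V / \<epsilon>))))"
\<comment> \<open>Each epoch costs \<open>3 * n\<close> evaluations and \<open>s0\<close> is at most
  9 times the iterated logarithm, which gives 27; the second phase contributes only a factor
  18.\<close>
proof (rule exI[of _ 27], intro conjI allI impI, goal_cases)
  case 1
  show ?case by simp
next
  case (2 n d X f h \<beta> xstar u0 \<gamma> D \<kappa> \<eta> opt V \<epsilon>)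
  then have problem: "composite_problem n d X f h \<beta>"
    and xstar: "is_arg_min (objective n f h) (\<lambda>x. x \<in> X) xstar"
    and u0: "u0 \<in> X" and \<gamma>: "\<gamma> > 0" and X: "compact X" "diameter X \<le> D"
    and \<eta>: "\<eta> > 0" "opt = Option_I \<longrightarrow> 2 * \<eta>\<^sup>2 > D\<^sup>2" and \<epsilon>: "\<epsilon> > 0"
    and V: "V = V_const opt \<beta> \<gamma> \<eta> D (objective n f h u0 - objective n f h xstar) (norm (u0 - xstar))"
    by auto
  interpret adavrag_setting n d X f h \<beta> xstar opt \<eta> D
  proof
    fix x y assume "x \<in> X" "y \<in> X"
    \<comment> \<open>Compactness enters through boundedness, which lets \<open>diameter\<close>
      bound distances.\<close>
    then have "dist x y \<le> diameter X"
      using X by (intro diameter_bounded_bound compact_imp_bounded)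
    then show "norm (x - y) \<le> D" using X by (simp add: dist_norm)
  qed (fact problem xstar \<eta>)+
  have "V \<ge> 0"
    unfolding V using V_const_split[of opt \<beta> \<gamma> \<eta> D "gap u0"] V_const_nonneg[OF \<gamma> \<eta>(2)] gap_nonneg[OF u0]
    by (simp add: add_nonneg_nonneg)
  then obtain S where S: "S \<ge> 1" "0 < weight n S" "V \<le> weight n S * \<epsilon>"
    "real (S * (3 * n)) \<le> 27 * (if \<epsilon> \<ge> V / real n then real n * loglog (V / \<epsilon>)
      else real n * loglog (real n) + sqrt (real n * V / \<epsilon>))"
    using epoch_count_exists[OF n _ \<epsilon>] by blast
  define run where "run = adavrag n d X f h opt \<eta> (a_sched n) (q_sched n) (\<lambda>_. n) u0 \<gamma> S"
  have a: "\<And>s. s \<ge> 1 \<Longrightarrow> 0 < a_sched n s \<and> a_sched n s < 1" and q: "\<And>s. s \<ge> 1 \<Longrightarrow> 0 < q_sched n s"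
    using a_sched_bounds[OF n] q_sched_pos[OF n] by auto
  have "weight n S * measure_pmf.expectation run (\<lambda>(u, x, \<gamma>', N). gap u) \<le> V"
    unfolding V run_def
    by (intro adavrag_gap_bound u0 \<gamma> a q a_q_sched weight_eq weight_decrease weight_0 n) auto
  then have "weight n S * measure_pmf.expectation run (\<lambda>(u, x, \<gamma>', N). gap u) \<le> weight n S * \<epsilon>"
    using S(3) by linarith
  then have "measure_pmf.expectation run (\<lambda>(u, x, \<gamma>', N). gap u) \<le> \<epsilon>"
    using S(2) by simp
  moreover have "real N \<le> 27 * (if \<epsilon> \<ge> V / real n then real n * loglog (V / \<epsilon>)
      else real n * loglog (real n) + sqrt (real n * V / \<epsilon>))"
    if "(u, x, \<gamma>', N) \<in> set_pmf run" for u x \<gamma>' N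
    using adavrag_invariant[OF u0 \<gamma> a q that[unfolded run_def]] S(4) by simp
  ultimately show ?case
    using S(1) unfolding run_def Let_def by (intro exI[of _ S]) blast
qed

end
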